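(* Let $\mathbb{S}$ be the unit sphere of $\mathbb{R}^n$, let $f_0$ be a probability measure on $\mathbb{S}$, and let $f\in C(\mathbb{R}_+,\mathcal{P}(\mathbb{S}))$ be the solution of $$\partial_t f+\nabla_v\cdot(f P_{v^\perp}J_f)=0,\qquad J_f(t)=\int_{\mathbb{S}} v\,f(t,v)\,\mathrm{d}v,$$ with initial condition $f(0,\cdot)=f_0$. Suppose $J_f(0)\neq 0$. Then: (1) The map $t\mapsto |J_f(t)|$ is nondecreasing, so $\Omega(t)=\frac{J_f(t)}{|J_f(t)|}\in\mathbb{S}$ is well-defined for all $t\geqslant 0$. (2) There exists $\Omega_\infty\in\mathbb{S}$ such that $\Omega(t)\to\Omega_\infty$ as $t\to+\infty$. (3) There exists a unique $v_{\mathrm{back}}\in\mathbb{S}$ such that the solution of the differential equation $\frac{\mathrm{d}v}{\mathrm{d}t}=P_{v^\perp}J_f(t)$ with initial condition $v(0)=v_{\mathrm{back}}$ satisfies $v(t)\to-\Omega_\infty$ as $t\to\infty$. (4) If $m$ denotes the mass of the singleton $\{v_{\mathrm{back}}\}$ with respect to $f_0$, then $m<\frac12$ and $f(t,\cdot)$ converges weakly, as $t\to\infty$, to the measure $(1-m)\delta_{\Omega_\infty}+m\,\delta_{-\Omega_\infty}$.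
   Context: For $v\in\mathbb{S}$ and $u\in\mathbb{R}^n$, $P_{v^\perp}u=u-(v\cdot u)v$. $\nabla_v$ and $\nabla_v\cdot$ are the gradient and divergence on $\mathbb{S}$. $\mathcal{P}(\mathbb{S})$ is the set of Borel probability measures on $\mathbb{S}$, and $C(\mathbb{R}_+,\mathcal{P}(\mathbb{S}))$ is the set of families of probability measures weakly continuous in time (i.e. $t\mapsto\int_{\mathbb{S}}\varphi\,\mathrm{d}f(t,\cdot)$ is continuous for each continuous $\varphi$ on $\mathbb{S}$). The notation $f(t,v)\,\mathrm{d}v$ is used for integration against the measure $f(t,\cdot)$ even if it has no density. The solution of the equation is the (unique) weak solution: for all $t\geqslant0$ and all $\varphi\in C^1(\mathbb{S})$, $$\frac{\mathrm{d}}{\mathrm{d}t}\int_{\mathbb{S}}\varphi(v)f(t,v)\,\mathrm{d}v=\int_{\mathbb{S}}J_f(t)\cdot\nabla_v\varphi(v)\,f(t,v)\,\mathrm{d}v .$$ Weak convergence of measures means convergence of integrals against all continuous functions on $\mathbb{S}$. *)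

theory Defs
  imports "HOL-Probability.Probability"
begin

abbreviation unit_sphere :: "(real ^ 'n) set"
  where "unit_sphere \<equiv> sphere 0 1"

definition proj_perp :: "real ^ 'n \<Rightarrow> real ^ 'n \<Rightarrow> real ^ 'n"
  where "proj_perp v u = u - (v \<bullet> u) *\<^sub>R v"


subsection \<open>Gradient and continuously differentiable functions on the sphere\<close>

text \<open>The derivative of a function along the sphere, \<^term>\<open>at v within unit_sphere\<close>, is determined
  only on the tangent space at \<open>v\<close>; the gradient is the unique tangent vector representing it.
  The values of \<open>\<phi>\<close> outside the sphere are irrelevant.\<close>

definition has_sphere_grad :: "(real ^ 'n \<Rightarrow> real) \<Rightarrow> real ^ 'n \<Rightarrow> real ^ 'n \<Rightarrow> bool"
  where "has_sphere_grad \<phi> g v \<longleftrightarrow>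
    v \<bullet> g = 0 \<and> (\<phi> has_derivative (\<lambda>h. g \<bullet> h)) (at v within unit_sphere)"

definition sphere_grad :: "(real ^ 'n \<Rightarrow> real) \<Rightarrow> real ^ 'n \<Rightarrow> real ^ 'n"
  where "sphere_grad \<phi> v = (THE g. has_sphere_grad \<phi> g v)"

definition C1_sphere :: "(real ^ 'n \<Rightarrow> real) \<Rightarrow> bool"
  where "C1_sphere \<phi> \<longleftrightarrow>
    (\<forall>v\<in>unit_sphere. \<exists>g. has_sphere_grad \<phi> g v) \<and> continuous_on unit_sphere (sphere_grad \<phi>)"

lemma has_sphere_grad_unique:
  fixes v :: "real ^ 'n"
  assumes v: "v \<in> unit_sphere" and g: "has_sphere_grad \<phi> g v" and g': "has_sphere_grad \<phi> g' v"
  shows "g = g'"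
proof (rule ccontr)
  assume "g \<noteq> g'"
  define d where "d = g - g'"
  define w where "w = d /\<^sub>R norm d"
  define c where "c = (\<lambda>s::real. cos s *\<^sub>R v + sin s *\<^sub>R w)"
  have d0: "d \<noteq> 0" using \<open>g \<noteq> g'\<close> by (simp add: d_def)
  have vv: "v \<bullet> v = 1" using v by (simp add: dot_square_norm)
  have vd: "v \<bullet> d = 0" using g g' by (simp add: has_sphere_grad_def d_def inner_diff_right)
  have vw: "v \<bullet> w = 0" "w \<bullet> v = 0" using vd by (simp_all add: w_def inner_commute)
  have ww: "w \<bullet> w = 1" using d0 by (simp add: w_def dot_square_norm power2_eq_square)
  have cS: "c s \<in> unit_sphere" for s
  proof -
    have "c s \<bullet> c s = (cos s)\<^sup>2 + (sin s)\<^sup>2"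
      using vv vw ww by (simp add: c_def inner_add_left inner_add_right power2_eq_square)
    then show ?thesis by (simp add: norm_eq_sqrt_inner)
  qed
  have c0: "c 0 = v" by (simp add: c_def)
  have "((\<lambda>x. \<phi> x - \<phi> x) has_derivative (\<lambda>h. g \<bullet> h - g' \<bullet> h)) (at v within unit_sphere)"
    using g g' unfolding has_sphere_grad_def by (intro has_derivative_diff) auto
  then have "((\<lambda>x::real ^ 'n. 0::real) has_derivative (\<lambda>h. d \<bullet> h)) (at v within unit_sphere)"
    by (simp add: d_def inner_diff_left)
  then have 1: "((\<lambda>x::real ^ 'n. 0::real) has_derivative (\<lambda>h. d \<bullet> h)) (at (c 0) within range c)"
    using cS c0 by (auto intro: has_derivative_subset)
  have 2: "(c has_derivative (\<lambda>s. s *\<^sub>R w)) (at 0)"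
    unfolding c_def by (auto intro!: derivative_eq_intros)
  have "((\<lambda>s. 0::real) has_derivative (\<lambda>s. d \<bullet> (s *\<^sub>R w))) (at (0::real))"
    using has_derivative_in_compose[OF 2 1] by simp
  then have "(\<lambda>s. d \<bullet> (s *\<^sub>R w)) = (\<lambda>s. 0)"
    using has_derivative_const has_derivative_unique by blast
  then have "d \<bullet> (1 *\<^sub>R w) = 0" by metis
  then show False using d0 by (simp add: w_def)
qed

lemma sphere_grad_eq:
  assumes "v \<in> unit_sphere" and "has_sphere_grad \<phi> g v"
  shows "sphere_grad \<phi> v = g"
  unfolding sphere_grad_def using assms has_sphere_grad_unique by blast

lemma has_sphere_grad_ambient:
  fixes v :: "real ^ 'n"
  assumes v: "v \<in> unit_sphere" and D: "(\<phi> has_derivative (\<lambda>h. G \<bullet> h)) (at v)"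
  shows "has_sphere_grad \<phi> (proj_perp v G) v"
proof -
  have vv: "v \<bullet> v = 1" using v by (simp add: dot_square_norm)
  define c where "c = (v \<bullet> G) / 2"
  have D': "(\<phi> has_derivative (\<lambda>h. G \<bullet> h)) (at v within unit_sphere)"
    using D by (rule has_derivative_at_withinI)
  have "((\<lambda>x. \<phi> x - c * (x \<bullet> x - 1)) has_derivative (\<lambda>h. G \<bullet> h - c * (v \<bullet> h + h \<bullet> v)))
      (at v within unit_sphere)"
    by (rule derivative_eq_intros D' refl)+ auto
  then have "(\<phi> has_derivative (\<lambda>h. G \<bullet> h - c * (v \<bullet> h + h \<bullet> v))) (at v within unit_sphere)"
    by (rule has_derivative_transform[OF v, rotated]) (simp add: dot_square_norm)
  moreover have "(\<lambda>h. G \<bullet> h - c * (v \<bullet> h + h \<bullet> v)) = (\<lambda>h. proj_perp v G \<bullet> h)"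
    by (simp add: c_def proj_perp_def inner_diff_left inner_commute[of _ v])
  ultimately show ?thesis
    using vv by (simp add: has_sphere_grad_def proj_perp_def inner_diff_right)
qed


subsection \<open>Probability measures on the sphere\<close>

abbreviation sphere_borel :: "(real ^ 'n) measure"
  where "sphere_borel \<equiv> restrict_space borel unit_sphere"

definition sphere_prob :: "(real ^ 'n) measure \<Rightarrow> bool"
  where "sphere_prob \<mu> \<longleftrightarrow> sets \<mu> = sets sphere_borel \<and> prob_space \<mu>"

definition first_moment :: "(real ^ 'n) measure \<Rightarrow> real ^ 'n"
  where "first_moment \<mu> = (LINT v|\<mu>. v)"

definition weakly_converges ::
    "('t \<Rightarrow> (real ^ 'n) measure) \<Rightarrow> (real ^ 'n) measure \<Rightarrow> 't filter \<Rightarrow> bool"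
  where "weakly_converges f \<mu> F \<longleftrightarrow>
    (\<forall>\<phi> :: real ^ 'n \<Rightarrow> real. continuous_on unit_sphere \<phi> \<longrightarrow>
      ((\<lambda>t. LINT v|f t. \<phi> v) \<longlongrightarrow> (LINT v|\<mu>. \<phi> v)) F)"

text \<open>\<open>mixture m \<mu> \<nu>\<close> is the convex combination \<open>(1 - m) \<mu> + m \<nu>\<close>, for \<open>0 \<le> m \<le> 1\<close> and
  measures on the same \<open>\<sigma>\<close>-algebra.\<close>

definition mixture :: "real \<Rightarrow> 'a measure \<Rightarrow> 'a measure \<Rightarrow> 'a measure"
  where "mixture m \<mu> \<nu> = measure_of (space \<mu>) (sets \<mu>)
    (\<lambda>A. ennreal (1 - m) * emeasure \<mu> A + ennreal m * emeasure \<nu> A)"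

definition dirac :: "real ^ 'n \<Rightarrow> (real ^ 'n) measure"
  where "dirac v = return sphere_borel v"

lemma sets_mixture [simp]: "sets (mixture m \<mu> \<nu>) = sets \<mu>"
  by (simp add: mixture_def)

lemma emeasure_mixture:
  assumes "sets \<nu> = sets \<mu>" and "A \<in> sets \<mu>"
  shows "emeasure (mixture m \<mu> \<nu>) A = ennreal (1 - m) * emeasure \<mu> A + ennreal m * emeasure \<nu> A"
  unfolding mixture_def
proof (rule emeasure_measure_of_sigma)
  show "sigma_algebra (space \<mu>) (sets \<mu>)" ..
  show "countably_additive (sets \<mu>)
      (\<lambda>A. ennreal (1 - m) * emeasure \<mu> A + ennreal m * emeasure \<nu> A)"
  proof (rule countably_additiveI)
    fix B :: "nat \<Rightarrow> _"
    assume B: "range B \<subseteq> sets \<mu>" "disjoint_family B"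
    have "(\<Sum>i. ennreal (1 - m) * emeasure \<mu> (B i) + ennreal m * emeasure \<nu> (B i)) =
        ennreal (1 - m) * (\<Sum>i. emeasure \<mu> (B i)) + ennreal m * (\<Sum>i. emeasure \<nu> (B i))"
      by (simp add: suminf_add[symmetric] ennreal_suminf_cmult)
    then show "(\<Sum>i. ennreal (1 - m) * emeasure \<mu> (B i) + ennreal m * emeasure \<nu> (B i)) =
        ennreal (1 - m) * emeasure \<mu> (\<Union>i. B i) + ennreal m * emeasure \<nu> (\<Union>i. B i)"
      using B assms(1) by (simp add: suminf_emeasure)
  qed
qed (use assms in \<open>auto simp: positive_def\<close>)


subsection \<open>The aggregation equation\<close>

definition sphere_weakly_continuous :: "(real \<Rightarrow> (real ^ 'n) measure) \<Rightarrow> bool"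
  where "sphere_weakly_continuous f \<longleftrightarrow>
    (\<forall>t\<ge>0. sphere_prob (f t)) \<and>
    (\<forall>\<phi> :: real ^ 'n \<Rightarrow> real. continuous_on unit_sphere \<phi> \<longrightarrow>
      continuous_on {0..} (\<lambda>t. LINT v|f t. \<phi> v))"

text \<open>Only times \<open>t \<ge> 0\<close> matter; at \<open>t = 0\<close> the time derivative is one-sided.\<close>

definition aggregation_solution ::
    "(real ^ 'n) measure \<Rightarrow> (real \<Rightarrow> (real ^ 'n) measure) \<Rightarrow> bool"
  where "aggregation_solution f0 f \<longleftrightarrow>
    sphere_weakly_continuous f \<and> f 0 = f0 \<and>
    (\<forall>t\<ge>0. \<forall>\<phi>. C1_sphere \<phi> \<longrightarrow>
      ((\<lambda>s. LINT v|f s. \<phi> v) has_real_derivative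
        (LINT v|f t. first_moment (f t) \<bullet> sphere_grad \<phi> v)) (at t within {0..}))"

definition direction :: "(real \<Rightarrow> (real ^ 'n) measure) \<Rightarrow> real \<Rightarrow> real ^ 'n"
  where "direction f t = first_moment (f t) /\<^sub>R norm (first_moment (f t))"

definition char_solution ::
    "(real \<Rightarrow> (real ^ 'n) measure) \<Rightarrow> real ^ 'n \<Rightarrow> (real \<Rightarrow> real ^ 'n) \<Rightarrow> bool"
  where "char_solution f v0 v \<longleftrightarrow>
    v 0 = v0 \<and>
    (\<forall>t\<ge>0. v t \<in> unit_sphere \<and>
      (v has_vector_derivative proj_perp (v t) (first_moment (f t))) (at t within {0..}))"

text \<open>The solution of the characteristic equation starting at \<open>v0\<close> exists, is unique as a function
  on \<open>{0..}\<close>, and tends to \<open>l\<close>.\<close>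

definition the_char_solution_tends_to ::
    "(real \<Rightarrow> (real ^ 'n) measure) \<Rightarrow> real ^ 'n \<Rightarrow> real ^ 'n \<Rightarrow> bool"
  where "the_char_solution_tends_to f v0 l \<longleftrightarrow>
    (\<exists>v. char_solution f v0 v \<and>
      (\<forall>w. char_solution f v0 w \<longrightarrow> (\<forall>t\<ge>0. w t = v t)) \<and>
      (v \<longlongrightarrow> l) at_top)"

end

theory Submission
  imports Defs
begin

text \<open>
  Write \<open>J\<close> for the first moment of \<open>f\<close>. The proof separates what happens to \<open>J\<close>, which follows
  from the weak equation alone, from what happens to individual flow lines of
  \<open>dv/dt = J - (v \<bullet> J) v\<close>, once \<open>J\<close> is known to converge.

  \<^emph>\<open>The first moment converges.\<close> Testing the equation with \<open>v\<close> and with \<open>(v \<bullet> J) v\<close> shows that \<open>J\<close>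
  is twice differentiable, with \<open>J' = J - S J\<close> where \<open>S\<close> is the matrix of second moments. The number
  \<open>J \<bullet> J' = |J|\<^sup>2 - J \<bullet> S J\<close>, called the spread below, is nonnegative; hence \<open>|J|\<close> is nondecreasing, and
  the spread has a finite time integral because \<open>|J| \<le> 1\<close>. A small spread forces \<open>f\<close> to concentrate
  near the line through \<open>J\<close>, so that \<open>S\<close> nearly annihilates the component of \<open>J'\<close> orthogonal to \<open>J\<close>, while
  the other component is itself controlled by the spread. Differentiating once more gives
  \<open>J' \<bullet> J'' \<ge> |J'|\<^sup>2 - C spread |J'|\<close>: apart from an integrable error, \<open>|J'|\<close> would have to grow
  exponentially. As \<open>|J'|\<close> is bounded, it must be integrable, so \<open>J\<close> converges. In the form used here,
  the increments of \<open>J\<close> are dominated by those of the bounded function \<open>|J'| + C |J|\<^sup>2 / 2\<close>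
  (\<open>J_increment_bound\<close>, \<open>J_convergent\<close>). The limit \<open>j \<Omega>\<close> is nonzero because \<open>|J|\<close> does not decrease.

  \<^emph>\<open>Flow lines of a converging field.\<close> For two flow lines \<open>v\<close>, \<open>w\<close> in the closed unit ball, the gap
  \<open>1 - v \<bullet> w\<close> solves the scalar linear equation with rate \<open>- J \<bullet> (v + w)\<close> (\<open>gap_derivative\<close>). This one
  identity gives uniqueness, continuous dependence, and invariance of the sphere and of the open ball. Near
  \<open>- \<Omega>\<close> the rate is close to \<open>2 j > 0\<close>, so at most one flow line on the sphere can converge to
  \<open>- \<Omega>\<close> (\<open>back_line_unique\<close>). One exists as a limit of flow lines that sit at \<open>- \<Omega>\<close> at time \<open>n\<close>: a
  point outside a small cap around \<open>- \<Omega>\<close> never gets back into it (\<open>back_line_exists\<close>). Any flow line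
  whose gap to the back line \<open>w\<close> is positive runs to \<open>\<Omega>\<close>; this applies to the flow line \<open>y\<close> in the
  ball that starts at the origin (\<open>front_line_tendsto\<close>).

  \<^emph>\<open>The limit of \<open>f\<close>.\<close> The flow acts on the sphere by Moebius maps, so gaps have conserved
  cross-ratios: along every flow line \<open>v\<close>,
  \<open>\<rho> = (1 - y \<bullet> y) (1 - v \<bullet> w) / ((1 - y \<bullet> w) (1 - v \<bullet> y))\<close> is constant. Consequently the integral of
  \<open>exp (- k \<rho>)\<close> against \<open>f t\<close> does not depend on \<open>t\<close> (\<open>cross_ratio_conserved\<close>), and the flow itself never
  has to be composed with \<open>f\<close>. Letting \<open>k\<close> tend to infinity shows that the atom of \<open>f t\<close> at \<open>w t\<close> keeps its
  mass \<open>m\<close>. On the other hand \<open>\<rho>\<close> tends to \<open>0\<close> uniformly away from \<open>\<Omega>\<close>, since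
  \<open>|y|\<close> tends to \<open>1\<close>; hence the mass away from \<open>\<Omega>\<close> is at most \<open>m\<close> in the limit, so everything except the atom ends up at \<open>\<Omega>\<close>
  (\<open>integral_tendsto\<close>). Integrating \<open>v \<bullet> \<Omega>\<close> yields \<open>1 - 2 m = j > 0\<close>.
\<close>

section \<open>Barriers for functions of one variable\<close>

lemma interval_derivative_mono:
  fixes h :: "real \<Rightarrow> real"
  assumes "a \<le> b"
    and "\<And>x. a \<le> x \<Longrightarrow> x \<le> b \<Longrightarrow> (h has_real_derivative h' x) (at x within {a..b})"
    and "\<And>x. a \<le> x \<Longrightarrow> x \<le> b \<Longrightarrow> h' x \<ge> 0"
  shows "h a \<le> h b"
proof -
  have "\<exists>x\<in>{a..b}. h b - h a = h' x * (b - a)"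
  proof (rule mvt_very_simple[OF \<open>a \<le> b\<close>])
    fix x assume "a \<le> x" "x \<le> b"
    then show "(h has_derivative (*) (h' x)) (at x within {a..b})"
      using assms(2)[of x] unfolding has_field_derivative_def by auto
  qed
  then show ?thesis using assms(1,3) by (metis atLeastAtMost_iff diff_ge_0_iff_ge mult_nonneg_nonneg)
qed

text \<open>A level that \<open>h\<close> can only cross upwards is a barrier: after the last time at which \<open>h\<close> is at least
  \<open>c\<close>, it would have to leave the level \<open>c\<close> downwards, against the sign of its derivative.\<close>
lemma barrier:
  fixes h :: "real \<Rightarrow> real"
  assumes "a \<le> b"
    and der: "\<And>x. a \<le> x \<Longrightarrow> x \<le> b \<Longrightarrow> (h has_real_derivative h' x) (at x within {a..b})"
    and pos: "\<And>x. a \<le> x \<Longrightarrow> x \<le> b \<Longrightarrow> h x = c \<Longrightarrow> h' x > 0"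
    and "h a \<ge> c"
  shows "h b \<ge> c"
proof (rule ccontr)
  assume "\<not> h b \<ge> c"
  have cont: "continuous_on {a..b} h"
    unfolding continuous_on_eq_continuous_within
  proof
    fix x assume "x \<in> {a..b}"
    then show "continuous (at x within {a..b}) h"
      using der[of x] by (auto intro: DERIV_continuous)
  qed
  define S where "S = {x\<in>{a..b}. c \<le> h x}"
  have "closed S" unfolding S_def
    by (rule continuous_on_closed_Collect_le[OF continuous_on_const cont]) simp
  then have "compact S"
    unfolding compact_eq_bounded_closed S_def by (auto intro: bounded_subset[of "{a..b}"])
  moreover have "a \<in> S" using assms by (auto simp: S_def)
  ultimately obtain s where s: "s \<in> S" "\<And>x. x \<in> S \<Longrightarrow> x \<le> s"
    using compact_attains_sup[of S] by blast
  have sb: "a \<le> s" "s < b" "c \<le> h s"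
    using s(1) \<open>\<not> h b \<ge> c\<close> by (auto simp: S_def order.order_iff_strict)
  have "\<exists>x\<ge>s. x \<le> b \<and> h x = c"
    by (rule IVT2'[of h b c s]) (use sb \<open>\<not> h b \<ge> c\<close> cont in \<open>auto intro: continuous_on_subset\<close>)
  then obtain x where "x \<ge> s" "x \<le> b" "h x = c" by blast
  moreover from this have "x \<le> s" using s(2)[of x] sb by (simp add: S_def)
  ultimately have "h s = c" by simp
  then obtain d where d: "d > 0" "\<And>e. e > 0 \<Longrightarrow> s + e \<in> {a..b} \<Longrightarrow> e < d \<Longrightarrow> h s < h (s + e)"
    using has_real_derivative_pos_inc_right[OF der[of s] pos[of s]] sb by auto
  define e where "e = min (d/2) (b - s)"
  have "e > 0" "e < d" "s + e \<le> b" using sb d(1) by (auto simp: e_def)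
  then have "s + e \<in> S" using d(2)[of e] sb by (auto simp: S_def)
  then show False using s(2)[of "s+e"] \<open>e > 0\<close> by simp
qed

text \<open>Below the level \<open>c\<close> the function climbs at a definite rate, so it cannot stay there; the
  barrier principle keeps it above \<open>c\<close> afterwards.\<close>
lemma eventually_exceeds:
  fixes h :: "real \<Rightarrow> real"
  assumes "\<kappa> > 0"
    and der: "\<And>x. T \<le> x \<Longrightarrow> (h has_real_derivative h' x) (at x within {T..})"
    and speed: "\<And>x. T \<le> x \<Longrightarrow> h x \<le> c \<Longrightarrow> h' x \<ge> \<kappa>"
  shows "\<exists>T'\<ge>T. \<forall>x\<ge>T'. h x \<ge> c"
proof -
  have "\<exists>t\<ge>T. h t \<ge> c"
  proof (rule ccontr)
    assume *: "\<not> (\<exists>t\<ge>T. h t \<ge> c)"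
    define t where "t = T + (\<bar>c - h T\<bar> + 1) / \<kappa>"
    have t: "T \<le> t" "\<kappa> * (t - T) = \<bar>c - h T\<bar> + 1" using assms(1) by (auto simp: t_def)
    have "h T - \<kappa> * T \<le> h t - \<kappa> * t"
    proof (rule interval_derivative_mono[where h = "\<lambda>x. h x - \<kappa> * x" and h' = "\<lambda>x. h' x - \<kappa>"])
      fix x assume "T \<le> x"
      have "(h has_real_derivative h' x) (at x within {T..t})"
        by (rule has_field_derivative_subset[OF der[OF \<open>T \<le> x\<close>]]) auto
      then show "((\<lambda>x. h x - \<kappa> * x) has_real_derivative h' x - \<kappa>) (at x within {T..t})"
        by (auto intro!: derivative_eq_intros)
      show "0 \<le> h' x - \<kappa>" using speed[of x] * \<open>T \<le> x\<close> by force
    qed (use t in auto)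
    then show False using * t by (auto simp: algebra_simps)
  qed
  then obtain t where t: "t \<ge> T" "h t \<ge> c" by blast
  have "h x \<ge> c" if "x \<ge> t" for x
  proof (rule barrier[of t x h h' c])
    fix y assume y: "t \<le> y" "y \<le> x"
    show "(h has_real_derivative h' y) (at y within {t..x})"
      by (rule has_field_derivative_subset[OF der]) (use t y in auto)
    assume "h y = c"
    then show "h' y > 0" using speed[of y] assms(1) t y by auto
  qed (use t that in auto)
  then show ?thesis using t by blast
qed

section \<open>Global solutions of ordinary differential equations\<close>

text \<open>Picard iteration becomes a contraction on the whole half-line when the curve is weighted by
  \<open>exp (- 2 L t)\<close>: a Lipschitz constant \<open>L\<close> then produces the contraction factor \<open>1/2\<close>. Boundedness of the
  right-hand side keeps the weighted curves bounded, so that the fixed point can be sought among bounded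
  continuous functions.\<close>
lemma picard_global:
  fixes F :: "real \<Rightarrow> 'a::banach \<Rightarrow> 'a"
  assumes cont: "continuous_on UNIV (\<lambda>(t, x). F t x)"
    and bdd: "\<And>t x. norm (F t x) \<le> B"
    and lip: "\<And>t x y. norm (F t x - F t y) \<le> L * norm (x - y)" and "L > 0"
  obtains u where "u 0 = x0" "\<And>t. t \<ge> 0 \<Longrightarrow> (u has_vector_derivative F t (u t)) (at t within {0..})"
proof -
  define k where "k = 2 * L"
  have k: "k > 0" using assms by (simp add: k_def)
  have "B \<ge> 0" using bdd[of 0 0] norm_ge_zero order_trans by blast
  (* z is the weighted curve and Z the right-hand side along the unweighted one. Bounded continuous
     functions live on all reals, so P extends the curve to the left of 0 by a constant. *)
  define Z where "Z z s = F s (exp (k * s) *\<^sub>R apply_bcontfun z s)" for z s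
  define P where "P z t = exp (- k * max 0 t) *\<^sub>R (x0 + integral {0..max 0 t} (Z z))" for z t
  have contZ: "continuous_on S (Z z)" for z S
  proof -
    have "continuous_on S ((\<lambda>(t, x). F t x) \<circ> (\<lambda>s. (s, exp (k * s) *\<^sub>R apply_bcontfun z s)))"
      by (rule continuous_on_compose)
        (auto intro!: continuous_intros continuous_on_subset[OF cont])
    then show ?thesis by (simp add: Z_def[abs_def] o_def)
  qed
  have intZ: "Z z integrable_on {0..t}" for z t
    by (rule integrable_continuous_interval[OF contZ])
  have expint: "((\<lambda>s. exp (k * s)) has_integral (exp (k * t) - 1) / k) {0..t}" if "t \<ge> 0" for t
  proof -
    have "((\<lambda>s. exp (k * s)) has_integral (exp (k * t) / k - exp (k * 0) / k)) {0..t}"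
      by (rule fundamental_theorem_of_calculus[OF that])
        (use k in \<open>auto intro!: derivative_eq_intros simp: has_real_derivative_iff_has_vector_derivative[symmetric]\<close>)
    then show ?thesis by (simp add: diff_divide_distrib)
  qed
  have Pb: "P z \<in> bcontfun" for z
  proof (rule bcontfun_normI)
    have "continuous_on UNIV ((\<lambda>\<tau>. integral {0..\<tau>} (Z z)) \<circ> (\<lambda>t. max 0 t))" 
    proof (rule continuous_on_compose)
      show "continuous_on (range (max 0)) (\<lambda>\<tau>. integral {0..\<tau>} (Z z))"
        unfolding continuous_on_eq_continuous_within
      proof
        fix x :: real assume "x \<in> range (max 0)"
        then have x: "0 \<le> x" by auto
        have "continuous_on {0..x+1} (\<lambda>\<tau>. integral {0..\<tau>} (Z z))"
          by (rule indefinite_integral_continuous_1[OF intZ])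
        then have "continuous (at x within {0..x+1}) (\<lambda>\<tau>. integral {0..\<tau>} (Z z))"
          using x by (auto simp: continuous_on_eq_continuous_within)
        moreover have "at x within {0..} = at x within {0..x+1}"
          by (rule at_within_nhd[of _ "{..<x+1}"]) auto
        ultimately have "continuous (at x within {0..}) (\<lambda>\<tau>. integral {0..\<tau>} (Z z))"
          by (simp add: continuous_within)
        then show "continuous (at x within range (max 0)) (\<lambda>\<tau>. integral {0..\<tau>} (Z z))"
          by (rule continuous_within_subset) auto
      qed
    qed (intro continuous_intros)
    then show "continuous_on UNIV (P z)"
      unfolding P_def[abs_def] o_def by (intro continuous_intros)
    fix t :: real
    define \<tau> where "\<tau> = max 0 t"
    have \<tau>: "\<tau> \<ge> 0" by (simp add: \<tau>_def)
    have "norm (integral {0..\<tau>} (Z z)) \<le> B * (\<tau> - 0)"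
      by (rule integral_bound[OF \<tau> contZ]) (auto simp: Z_def bdd)
    then have "norm (P z t) \<le> exp (- k * \<tau>) * (norm x0 + B * \<tau>)"
      unfolding P_def \<tau>_def[symmetric] norm_scaleR
      by (auto intro!: mult_left_mono norm_triangle_le)
    also have "\<dots> = exp (- k * \<tau>) * norm x0 + (B / k) * (exp (- k * \<tau>) * (k * \<tau>))"
      using k by (simp add: field_simps)
    also have "\<dots> \<le> 1 * norm x0 + (B / k) * 1"
    proof (intro add_mono mult_mono mult_right_mono)
      have "k * \<tau> \<le> exp (k * \<tau>)" using exp_ge_add_one_self[of "k * \<tau>"] by linarith
      then show "exp (- k * \<tau>) * (k * \<tau>) \<le> 1"
        by (simp add: exp_minus field_simps)
    qed (use k \<tau> \<open>B \<ge> 0\<close> in auto)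
    finally show "norm (P z t) \<le> norm x0 + B / k" by simp
  qed
  define Q where "Q z = Bcontfun (P z)" for z
  have Q: "apply_bcontfun (Q z) = P z" for z
    unfolding Q_def using Pb by (rule Bcontfun_inverse)
  have "\<exists>!z. Q z = z"
  proof (rule banach_fix_type)
    show "\<forall>z z'. dist (Q z) (Q z') \<le> (1/2) * dist z z'"
    proof (intro allI dist_bound)
      fix z z' :: "real \<Rightarrow>\<^sub>C 'a" and t :: real
      define \<tau> where "\<tau> = max 0 t"
      have \<tau>: "\<tau> \<ge> 0" by (simp add: \<tau>_def)
      define d where "d = dist z z'"
      have "norm (integral {0..\<tau>} (\<lambda>s. Z z s - Z z' s)) \<le> integral {0..\<tau>} (\<lambda>s. L * d * exp (k * s))"
      proof (rule integral_norm_bound_integral)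
        fix s assume "s \<in> {0..\<tau>}"
        have "norm (Z z s - Z z' s) \<le> L * norm (exp (k * s) *\<^sub>R apply_bcontfun z s - exp (k * s) *\<^sub>R apply_bcontfun z' s)"
          unfolding Z_def by (rule lip)
        also have "\<dots> = L * (exp (k * s) * dist (apply_bcontfun z s) (apply_bcontfun z' s))"
          by (simp add: dist_norm scaleR_diff_right[symmetric])
        also have "\<dots> \<le> L * (exp (k * s) * d)"
          unfolding d_def using \<open>L > 0\<close> by (intro mult_left_mono dist_bounded) auto
        finally show "norm (Z z s - Z z' s) \<le> L * d * exp (k * s)" by (simp add: algebra_simps)
      next
        show "(\<lambda>s. L * d * exp (k * s)) integrable_on {0..\<tau>}"
          by (intro integrable_continuous_interval continuous_intros)
      qed (intro integrable_diff intZ)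
      also have "\<dots> = L * d * ((exp (k * \<tau>) - 1) / k)"
        by (rule integral_unique[OF has_integral_mult_right[OF expint[OF \<tau>]]])
      also have "\<dots> = d / 2 * (exp (k * \<tau>) - 1)"
        using \<open>L > 0\<close> by (simp add: k_def)
      also have "\<dots> \<le> d / 2 * exp (k * \<tau>)"
        by (intro mult_left_mono) (auto simp: d_def)
      finally have 1: "norm (integral {0..\<tau>} (\<lambda>s. Z z s - Z z' s)) \<le> d / 2 * exp (k * \<tau>)" .
      have "dist (P z t) (P z' t) = exp (- k * \<tau>) * norm (integral {0..\<tau>} (\<lambda>s. Z z s - Z z' s))"
        unfolding P_def \<tau>_def[symmetric] dist_norm
        by (simp add: integral_diff intZ scaleR_diff_right[symmetric])
      also have "\<dots> \<le> exp (- k * \<tau>) * (d / 2 * exp (k * \<tau>))"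
        by (intro mult_left_mono 1) auto
      also have "\<dots> = d / 2" by (simp add: exp_minus)
      finally show "dist (apply_bcontfun (Q z) t) (apply_bcontfun (Q z') t) \<le> (1/2) * dist z z'"
        by (simp add: Q d_def)
    qed
  qed auto
  then obtain z where z: "Q z = z" by blast
  define u where "u t = x0 + integral {0..t} (Z z)" for t
  have Zu: "Z z t = F t (u t)" if "t \<ge> 0" for t
  proof -
    have "apply_bcontfun z t = exp (- k * t) *\<^sub>R u t"
      using Q[of z] that by (simp add: z P_def u_def max_def)
    then show ?thesis by (simp add: Z_def exp_minus)
  qed
  show ?thesis
  proof
    show "u 0 = x0" by (simp add: u_def)
    fix t :: real assume t: "t \<ge> 0"
    have "((\<lambda>t. integral {0..t} (Z z)) has_vector_derivative Z z t) (at t within {0..t+1})"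
      by (rule integral_has_vector_derivative[OF contZ]) (use t in auto)
    then have "(u has_vector_derivative Z z t) (at t within {0..t+1})"
      unfolding u_def[abs_def] by (auto intro!: derivative_eq_intros)
    moreover have "at t within {0..} = at t within {0..t+1}"
      by (rule at_within_nhd[of _ "{..<t+1}"]) auto
    ultimately show "(u has_vector_derivative F t (u t)) (at t within {0..})"
      using Zu[OF t] by (simp add: has_vector_derivative_def)
  qed
qed

section \<open>Flow lines in the closed unit ball\<close>

text \<open>Curves in the closed ball are admitted, not only curves on the sphere, because the flow line
  starting at the origin is needed to normalise the conserved cross-ratio.\<close>
definition flow_line_on :: "real set \<Rightarrow> (real \<Rightarrow> real ^ 'n) \<Rightarrow> (real \<Rightarrow> real ^ 'n) \<Rightarrow> bool"
  where "flow_line_on S J v \<longleftrightarrow>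
    (\<forall>t\<in>S. norm (v t) \<le> 1 \<and> (v has_vector_derivative proj_perp (v t) (J t)) (at t within S))"

lemma flow_line_on_subset: "flow_line_on S J v \<Longrightarrow> T \<subseteq> S \<Longrightarrow> flow_line_on T J v"
  unfolding flow_line_on_def by (meson has_vector_derivative_within_subset subsetD)

lemma flow_line_onD:
  assumes "flow_line_on S J v" "t \<in> S"
  shows "norm (v t) \<le> 1" "(v has_vector_derivative proj_perp (v t) (J t)) (at t within S)"
  using assms by (auto simp: flow_line_on_def)

lemma inner_le_one:
  fixes v w :: "'a::real_inner"
  assumes "norm v \<le> 1" "norm w \<le> 1"
  shows "\<bar>v \<bullet> w\<bar> \<le> 1"
  using Cauchy_Schwarz_ineq2[of v w] assms mult_mono[of "norm v" 1 "norm w" 1] by simp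

lemma norm_diff_le_gap:
  fixes v w :: "'a::real_inner"
  assumes "norm v \<le> 1" "norm w \<le> 1"
  shows "(norm (v - w))\<^sup>2 \<le> 2 * (1 - v \<bullet> w)"
proof -
  have "(norm (v - w))\<^sup>2 = (norm v)\<^sup>2 + (norm w)\<^sup>2 - 2 * (v \<bullet> w)"
    by (simp add: power2_norm_eq_inner inner_diff_left inner_diff_right inner_commute[of w v])
  moreover have "(norm v)\<^sup>2 \<le> 1" "(norm w)\<^sup>2 \<le> 1" using assms by (auto simp: power_le_one)
  ultimately show ?thesis by simp
qed

lemma tendsto_if_gap_tendsto_0:
  fixes v w :: "'b \<Rightarrow> 'a::real_inner"
  assumes "\<forall>\<^sub>F t in F. norm (v t) \<le> 1" "norm l \<le> 1" "((\<lambda>t. 1 - v t \<bullet> l) \<longlongrightarrow> 0) F"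
  shows "(v \<longlongrightarrow> l) F"
proof -
  have "((\<lambda>t. (norm (v t - l))\<^sup>2) \<longlongrightarrow> 0) F"
  proof (rule tendsto_sandwich[of "\<lambda>_. 0"])
    show "\<forall>\<^sub>F t in F. (norm (v t - l))\<^sup>2 \<le> 2 * (1 - v t \<bullet> l)"
      using assms(1) by eventually_elim (rule norm_diff_le_gap[OF _ assms(2)])
    show "((\<lambda>t. 2 * (1 - v t \<bullet> l)) \<longlongrightarrow> 0) F"
      by (rule tendsto_mult_right_zero[OF assms(3)])
  qed auto
  then have "((\<lambda>t. sqrt ((norm (v t - l))\<^sup>2)) \<longlongrightarrow> sqrt 0) F" by (rule tendsto_real_sqrt)
  then show ?thesis by (simp add: tendsto_norm_zero_iff LIM_zero_iff)
qed

text \<open>The quadratic terms of the two velocities combine with the linear ones into a multiple of the gap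
  itself; this is what remains of the conformality of the flow for a pair of flow lines.\<close>
lemma gap_derivative:
  assumes "flow_line_on S J v" "flow_line_on S J w" "t \<in> S"
  shows "((\<lambda>t. 1 - v t \<bullet> w t) has_real_derivative - (J t \<bullet> (v t + w t)) * (1 - v t \<bullet> w t)) (at t within S)"
proof -
  have "((\<lambda>t. v t \<bullet> w t) has_vector_derivative
      (v t \<bullet> proj_perp (w t) (J t) + proj_perp (v t) (J t) \<bullet> w t)) (at t within S)"
    by (rule bounded_bilinear.has_vector_derivative[OF bounded_bilinear_inner])
      (use assms in \<open>auto simp: flow_line_on_def\<close>)
  moreover have "v t \<bullet> proj_perp (w t) (J t) + proj_perp (v t) (J t) \<bullet> w t = (J t \<bullet> (v t + w t)) * (1 - v t \<bullet> w t)"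
    by (simp add: proj_perp_def inner_simps algebra_simps inner_commute)
  ultimately show ?thesis
    unfolding has_real_derivative_iff_has_vector_derivative[symmetric]
    by (auto intro!: derivative_eq_intros)
qed

text \<open>The rate in the equation for the gap is at most \<open>2\<close> in absolute value. Both directions of the
  Gronwall estimate are used: the first for continuous dependence, the second to transport positivity of a
  gap forward in time. The case \<open>v = w\<close> gives the invariance of the sphere and of the open ball.\<close>
lemma gap_growth:
  assumes v: "flow_line_on {a..b} J v" and w: "flow_line_on {a..b} J w" and "a \<le> b"
    and J: "\<And>t. t \<in> {a..b} \<Longrightarrow> norm (J t) \<le> 1"
  shows "1 - v b \<bullet> w b \<le> exp (2 * (b - a)) * (1 - v a \<bullet> w a)"
    and "1 - v a \<bullet> w a \<le> exp (2 * (b - a)) * (1 - v b \<bullet> w b)"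
proof -
  let ?D = "\<lambda>t. 1 - v t \<bullet> w t"
  have D: "?D t \<ge> 0" "\<bar>J t \<bullet> (v t + w t)\<bar> \<le> 2" if "t \<in> {a..b}" for t
  proof -
    have n: "norm (v t) \<le> 1" "norm (w t) \<le> 1" using v w that by (auto simp: flow_line_on_def)
    show "?D t \<ge> 0" using inner_le_one[OF n] by simp
    show "\<bar>J t \<bullet> (v t + w t)\<bar> \<le> 2"
      using inner_le_one[OF J[OF that] n(1)] inner_le_one[OF J[OF that] n(2)] by (simp add: inner_add_right)
  qed
  have "exp (2 * a) * ?D a \<le> exp (2 * b) * ?D b"
  proof (rule interval_derivative_mono[OF \<open>a \<le> b\<close>])
    fix t assume t: "a \<le> t" "t \<le> b"
    show "((\<lambda>t. exp (2 * t) * ?D t) has_real_derivative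
        exp (2 * t) * (2 - J t \<bullet> (v t + w t)) * ?D t) (at t within {a..b})"
      by (rule derivative_eq_intros gap_derivative[OF v w] refl)+ (use t in \<open>auto simp: algebra_simps\<close>)
    show "0 \<le> exp (2 * t) * (2 - J t \<bullet> (v t + w t)) * ?D t" using D[of t] t by simp
  qed
  then show "?D a \<le> exp (2 * (b - a)) * ?D b"
    by (simp add: right_diff_distrib exp_diff field_simps)
  have "- exp (- 2 * a) * ?D a \<le> - exp (- 2 * b) * ?D b"
  proof (rule interval_derivative_mono[OF \<open>a \<le> b\<close>])
    fix t assume t: "a \<le> t" "t \<le> b"
    show "((\<lambda>t. - exp (- 2 * t) * ?D t) has_real_derivative
        exp (- 2 * t) * (2 + J t \<bullet> (v t + w t)) * ?D t) (at t within {a..b})"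
      by (rule derivative_eq_intros gap_derivative[OF v w] refl)+ (use t in \<open>auto simp: algebra_simps\<close>)
    show "0 \<le> exp (- 2 * t) * (2 + J t \<bullet> (v t + w t)) * ?D t" using D[of t] t by simp
  qed
  then show "?D b \<le> exp (2 * (b - a)) * ?D a"
    by (simp add: right_diff_distrib exp_diff exp_minus field_simps)
qed

lemma flow_line_unique:
  assumes v: "flow_line_on {0..} J v" and w: "flow_line_on {0..} J w"
    and J: "\<And>t. t \<ge> 0 \<Longrightarrow> norm (J t) \<le> 1"
    and "v 0 = w 0" "norm (v 0) = 1" "t \<ge> 0"
  shows "v t = w t"
proof -
  have n: "norm (v t) \<le> 1" "norm (w t) \<le> 1" using v w \<open>t \<ge> 0\<close> by (auto simp: flow_line_on_def)
  have "1 - v t \<bullet> w t \<le> exp (2 * (t - 0)) * (1 - v 0 \<bullet> w 0)"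
    by (rule gap_growth(1)[of 0 t J]) (use v w J \<open>t \<ge> 0\<close> in \<open>auto intro: flow_line_on_subset\<close>)
  also have "1 - v 0 \<bullet> w 0 = 0"
    using assms(4,5) by (simp add: power2_norm_eq_inner[symmetric])
  finally have "1 - v t \<bullet> w t \<le> 0" by simp
  then have "2 * (1 - v t \<bullet> w t) \<le> 0" by simp
  with norm_diff_le_gap[OF n] have "(norm (v t - w t))\<^sup>2 \<le> 0" by (rule order_trans)
  then have "norm (v t - w t) = 0" by (metis power2_less_eq_zero_iff)
  then show ?thesis by simp
qed

lemma flow_line_norm_eq_1:
  assumes "flow_line_on {a..b} J v" "\<And>t. t \<in> {a..b} \<Longrightarrow> norm (J t) \<le> 1" "a \<le> b" "norm (v a) = 1"
  shows "norm (v b) = 1"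
proof -
  have "1 - v b \<bullet> v b \<le> exp (2 * (b - a)) * (1 - v a \<bullet> v a)"
    by (rule gap_growth(1)[OF assms(1,1,3,2)])
  then have "(norm (v b))\<^sup>2 \<ge> 1" using assms(4) by (simp add: power2_norm_eq_inner[symmetric])
  then have "norm (v b) \<ge> 1" by (metis norm_ge_zero one_le_power power2_nonneg_ge_1_iff)
  moreover have "norm (v b) \<le> 1" using flow_line_onD(1)[OF assms(1), of b] assms(3) by simp
  ultimately show ?thesis by simp
qed

lemma flow_line_norm_less_1:
  assumes "flow_line_on {a..b} J v" "\<And>t. t \<in> {a..b} \<Longrightarrow> norm (J t) \<le> 1" "a \<le> b" "norm (v a) < 1"
  shows "norm (v b) < 1"
proof -
  have "1 - v a \<bullet> v a \<le> exp (2 * (b - a)) * (1 - v b \<bullet> v b)"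
    by (rule gap_growth(2)[OF assms(1,1,3,2)])
  moreover have "v a \<bullet> v a < 1" using assms(4)
    by (simp add: power2_norm_eq_inner[symmetric] power_less_one_iff)
  ultimately have "0 < exp (2 * (b - a)) * (1 - v b \<bullet> v b)" by linarith
  then have "(norm (v b))\<^sup>2 < 1" by (simp add: zero_less_mult_iff power2_norm_eq_inner)
  then show ?thesis by (simp add: power_less_one_iff)
qed

lemma closest_point_cball_0_1:
  fixes x :: "'a::euclidean_space"
  assumes "norm x \<ge> 1"
  shows "closest_point (cball 0 1) x = x /\<^sub>R norm x"
proof (rule any_closest_point_unique[of "cball 0 1" _ _ x])
  show "\<forall>z\<in>cball 0 1. dist x (closest_point (cball 0 1) x) \<le> dist x z"
    by (auto intro: closest_point_le)
  show "\<forall>z\<in>cball 0 1. dist x (x /\<^sub>R norm x) \<le> dist x z"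
  proof
    fix z :: 'a assume "z \<in> cball 0 1"
    have "x \<noteq> 0" using assms by auto
    have "x - x /\<^sub>R norm x = (1 - inverse (norm x)) *\<^sub>R x" by (simp add: algebra_simps)
    then have "dist x (x /\<^sub>R norm x) = (1 - inverse (norm x)) * norm x"
      using assms by (simp add: dist_norm inverse_le_1_iff)
    also have "\<dots> = norm x - 1" using assms \<open>x \<noteq> 0\<close> by (simp add: field_simps)
    also have "\<dots> \<le> dist x z" using \<open>z \<in> cball 0 1\<close> norm_triangle_ineq2[of x z] by (simp add: dist_norm)
    finally show "dist x (x /\<^sub>R norm x) \<le> dist x z" .
  qed
  show "x /\<^sub>R norm x \<in> cball 0 1" using assms by (cases "x = 0") auto
  show "closest_point (cball 0 1) x \<in> cball 0 1" by (rule closest_point_in_set) auto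
qed auto

text \<open>The velocity is quadratic in \<open>v\<close>, hence not globally Lipschitz. Precomposing it with the
  projection onto the ball makes it so. Outside the ball the modified velocity is orthogonal to \<open>v\<close>, so the
  solution stays inside, where the modification is invisible.\<close>
lemma flow_line_exists:
  fixes J :: "real \<Rightarrow> real ^ 'n"
  assumes cont: "continuous_on UNIV J" and J: "\<And>t. norm (J t) \<le> 1" and "norm x0 \<le> 1"
  obtains v where "v 0 = x0" "flow_line_on {0..} J v"
proof -
  define \<pi> :: "real ^ 'n \<Rightarrow> real ^ 'n" where "\<pi> = closest_point (cball 0 1)"
  have \<pi>1: "norm (\<pi> x) \<le> 1" for x
    using closest_point_in_set[of "cball 0 1" x] by (simp add: \<pi>_def)
  have \<pi>lip: "norm (\<pi> x - \<pi> y) \<le> norm (x - y)" for x y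
    using closest_point_lipschitz[of "cball 0 1" x y] by (simp add: \<pi>_def dist_norm)
  have \<pi>id: "\<pi> x = x" if "norm x \<le> 1" for x using that by (simp add: \<pi>_def closest_point_self)
  have \<pi>cont: "continuous_on UNIV \<pi>"
    unfolding \<pi>_def by (rule continuous_on_closest_point) auto
  define F where "F t x = proj_perp (\<pi> x) (J t)" for t x
  obtain v where v: "v 0 = x0" "\<And>t. t \<ge> 0 \<Longrightarrow> (v has_vector_derivative F t (v t)) (at t within {0..})"
  proof (rule picard_global[of F 2 2 x0])
    show "continuous_on UNIV (\<lambda>(t, x). F t x)"
      unfolding F_def proj_perp_def case_prod_unfold
      by (intro continuous_intros continuous_on_compose2[OF \<pi>cont] continuous_on_compose2[OF cont]) auto
    fix t x y
    have c: "\<bar>\<pi> z \<bullet> J t\<bar> \<le> 1" for z by (rule inner_le_one[OF \<pi>1 J])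
    have "norm (F t x) \<le> norm (J t) + \<bar>\<pi> x \<bullet> J t\<bar> * norm (\<pi> x)"
      unfolding F_def proj_perp_def using norm_triangle_ineq4 by (metis norm_scaleR)
    also have "\<dots> \<le> 1 + 1 * 1" by (intro add_mono mult_mono J c \<pi>1) auto
    finally show "norm (F t x) \<le> 2" by simp
    have "F t x - F t y = (\<pi> y \<bullet> J t) *\<^sub>R (\<pi> y - \<pi> x) + ((\<pi> y - \<pi> x) \<bullet> J t) *\<^sub>R \<pi> x"
      by (simp add: F_def proj_perp_def algebra_simps)
    also have "norm \<dots> \<le> \<bar>\<pi> y \<bullet> J t\<bar> * norm (\<pi> y - \<pi> x) + \<bar>(\<pi> y - \<pi> x) \<bullet> J t\<bar> * norm (\<pi> x)"
      using norm_triangle_ineq by (metis norm_scaleR)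
    also have "\<dots> \<le> 1 * norm (\<pi> y - \<pi> x) + (norm (\<pi> y - \<pi> x) * norm (J t)) * 1"
      by (intro add_mono mult_mono c \<pi>1 Cauchy_Schwarz_ineq2) auto
    also have "\<dots> \<le> 2 * norm (\<pi> y - \<pi> x)"
      using mult_left_mono[OF J[of t], of "norm (\<pi> y - \<pi> x)"] by simp
    also have "\<dots> \<le> 2 * norm (x - y)" using \<pi>lip[of y x] by (simp add: norm_minus_commute)
    finally show "norm (F t x - F t y) \<le> 2 * norm (x - y)" .
  qed auto
  have le: "norm (v t) \<le> 1" if "t \<ge> 0" for t
  proof -
    have "(norm (v t))\<^sup>2 - 1 \<le> 0 + e * (1 + t)" if "e > 0" for e
    proof -
      (* On the sphere itself the norm has derivative zero, so a barrier needs some slack: the bound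
         1 + e (1 + s) increases strictly while the norm stands still above 1. *)
      define h where "h s = e * (1 + s) + 1 - v s \<bullet> v s" for s
      have "h t \<ge> 0"
      proof (rule barrier[of 0 t h "\<lambda>s. e - 2 * (v s \<bullet> F s (v s))"])
        fix s assume s: "0 \<le> s" "s \<le> t"
        have d: "(v has_vector_derivative F s (v s)) (at s within {0..t})"
          by (rule has_vector_derivative_within_subset[OF v(2)]) (use s in auto)
        have "((\<lambda>s. v s \<bullet> v s) has_real_derivative v s \<bullet> F s (v s) + F s (v s) \<bullet> v s) (at s within {0..t})"
          unfolding has_real_derivative_iff_has_vector_derivative
          by (rule bounded_bilinear.has_vector_derivative[OF bounded_bilinear_inner d d])
        then show "(h has_real_derivative e - 2 * (v s \<bullet> F s (v s))) (at s within {0..t})"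
          unfolding h_def[abs_def] by (auto intro!: derivative_eq_intros simp: inner_commute)
        assume "h s = 0"
        then have "v s \<bullet> v s > 1" using mult_pos_pos[of e "1 + s"] \<open>e > 0\<close> s(1) unfolding h_def by linarith
        then have n: "norm (v s) > 1" by (simp add: power2_norm_eq_inner[symmetric] power2_nonneg_gt_1_iff)
        then have "\<pi> (v s) = v s /\<^sub>R norm (v s)"
          unfolding \<pi>_def by (intro closest_point_cball_0_1) simp
        then have "v s \<bullet> F s (v s) = v s \<bullet> J s - (v s \<bullet> J s) / norm (v s) * (v s \<bullet> v s / norm (v s))"
          by (simp add: F_def proj_perp_def inner_simps field_simps)
        also have "\<dots> = 0" using n by (simp add: power2_norm_eq_inner[symmetric] power2_eq_square)
        finally show "e - 2 * (v s \<bullet> F s (v s)) > 0" using that by simp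
      qed (use \<open>t \<ge> 0\<close> that v(1) assms(3) in \<open>auto simp: h_def power2_norm_eq_inner[symmetric] power_le_one add_increasing\<close>)
      then show ?thesis by (simp add: h_def power2_norm_eq_inner)
    qed
    then have *: "(norm (v t))\<^sup>2 - 1 \<le> e" if "e > 0" for e
      using that \<open>t \<ge> 0\<close> by (metis add_0 add_pos_nonneg divide_pos_pos less_numeral_extra(1) nonzero_mult_div_cancel_right order_less_irrefl times_divide_eq_left)
    have "(norm (v t))\<^sup>2 - 1 \<le> 0" by (rule field_le_epsilon) (use * in auto)
    then show ?thesis by (simp add: power_le_one_iff)
  qed
  show ?thesis
  proof
    show "flow_line_on {0..} J v"
      unfolding flow_line_on_def using v(2) le by (auto simp: F_def \<pi>id)
  qed (rule v(1))
qed

section \<open>Flow lines of a converging field\<close>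

text \<open>On the boundary of the cap \<open>v \<bullet> \<Omega> \<le> \<epsilon> - 1\<close> the exact field \<open>j \<Omega>\<close> pushes outwards at
  speed \<open>j (1 - (\<epsilon> - 1)\<^sup>2) \<ge> j \<epsilon>\<close>, which beats the perturbation of size below
  \<open>2 (j \<epsilon> / 2)\<close>. Read backwards in time, the cap is invariant.\<close>
lemma flow_line_leaves_back_cap:
  fixes \<Omega> :: "real ^ 'n"
  assumes v: "flow_line_on {a..b} J v" and "a \<le> b"
    and close: "\<And>t. t \<in> {a..b} \<Longrightarrow> norm (J t - j *\<^sub>R \<Omega>) < j * \<epsilon> / 2"
    and "0 < \<epsilon>" "\<epsilon> \<le> 1" "j > 0" "norm \<Omega> = 1" and start: "v a \<bullet> \<Omega> \<ge> \<epsilon> - 1"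
  shows "v b \<bullet> \<Omega> \<ge> \<epsilon> - 1"
proof (rule barrier[of a b "\<lambda>t. v t \<bullet> \<Omega>" "\<lambda>t. proj_perp (v t) (J t) \<bullet> \<Omega>"])
  fix t assume t: "a \<le> t" "t \<le> b"
  show "((\<lambda>t. v t \<bullet> \<Omega>) has_real_derivative proj_perp (v t) (J t) \<bullet> \<Omega>) (at t within {a..b})"
    unfolding has_real_derivative_iff_has_vector_derivative
    using bounded_linear.has_vector_derivative[OF bounded_linear_inner_left flow_line_onD(2)[OF v]] t
    by auto
  assume p: "v t \<bullet> \<Omega> = \<epsilon> - 1"
  define E where "E = J t - j *\<^sub>R \<Omega>"
  have J: "J t = j *\<^sub>R \<Omega> + E" by (simp add: E_def)
  have nv: "norm (v t) \<le> 1" using flow_line_onD(1)[OF v] t by simp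
  have \<Omega>\<Omega>: "\<Omega> \<bullet> \<Omega> = 1" using assms(7) by (simp add: power2_norm_eq_inner[symmetric])
  have "proj_perp (v t) (J t) \<bullet> \<Omega> = j * (1 - (\<epsilon> - 1)\<^sup>2) + E \<bullet> (\<Omega> - (\<epsilon> - 1) *\<^sub>R v t)"
    unfolding J proj_perp_def p[symmetric] using \<Omega>\<Omega>
    by (simp add: inner_simps inner_commute[of \<Omega> "v t"] inner_commute[of E] power2_eq_square algebra_simps)
  moreover have "\<bar>E \<bullet> (\<Omega> - (\<epsilon> - 1) *\<^sub>R v t)\<bar> \<le> norm E * 2"
  proof -
    have "norm (\<Omega> - (\<epsilon> - 1) *\<^sub>R v t) \<le> norm \<Omega> + \<bar>\<epsilon> - 1\<bar> * norm (v t)"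
      by (metis norm_scaleR norm_triangle_ineq4)
    also have "\<dots> \<le> 1 + 1 * 1" using assms nv by (intro add_mono mult_mono) auto
    finally have "norm E * norm (\<Omega> - (\<epsilon> - 1) *\<^sub>R v t) \<le> norm E * 2" by (intro mult_left_mono) auto
    then show ?thesis using Cauchy_Schwarz_ineq2 order_trans by blast
  qed
  moreover have "norm E * 2 < j * \<epsilon>" using close[of t] t by (simp add: E_def)
  moreover have "j * \<epsilon> \<le> j * (1 - (\<epsilon> - 1)\<^sup>2)"
  proof (rule mult_left_mono)
    have "1 - (\<epsilon> - 1)\<^sup>2 - \<epsilon> = \<epsilon> * (1 - \<epsilon>)" by (simp add: power2_eq_square algebra_simps)
    also have "\<dots> \<ge> 0" using assms by simp
    finally show "\<epsilon> \<le> 1 - (\<epsilon> - 1)\<^sup>2" by simp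
  qed (use \<open>j > 0\<close> in simp)
  ultimately show "proj_perp (v t) (J t) \<bullet> \<Omega> > 0" by linarith
qed (use assms in auto)

locale convergent_field =
  fixes J :: "real \<Rightarrow> real ^ 'n" and j :: real and \<Omega> :: "real ^ 'n"
  assumes cont: "continuous_on {0..} J"
    and norm_le: "\<And>t. t \<ge> 0 \<Longrightarrow> norm (J t) \<le> 1"
    and lim: "(J \<longlongrightarrow> j *\<^sub>R \<Omega>) at_top"
    and j_pos: "j > 0" and norm_\<Omega>: "norm \<Omega> = 1"
begin

text \<open>Flow lines are constructed for fields given at all real times, also negative ones, so that \<open>J\<close> is
  extended by its value at \<open>0\<close>.\<close>
lemma cont_extended: "continuous_on UNIV (\<lambda>t. J (max 0 (g t)))" if "continuous_on UNIV g" for g :: "real \<Rightarrow> real"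
  by (rule continuous_on_compose2[OF cont]) (auto intro!: continuous_intros that)

lemma flow_line_from:
  assumes "norm x0 \<le> 1"
  obtains v where "v 0 = x0" "flow_line_on {0..} J v"
proof -
  have "continuous_on UNIV (\<lambda>t. J (max 0 t))" by (rule cont_extended) auto
  from flow_line_exists[OF this _ assms] norm_le
  obtain v where "v 0 = x0" "flow_line_on {0..} (\<lambda>t. J (max 0 t)) v" by auto
  then show ?thesis using that[of v] by (simp add: flow_line_on_def max_def)
qed

text \<open>The reversed curve is a flow line of the reversed field \<open>s \<mapsto> - J (T - s)\<close>.\<close>
lemma flow_line_ending_at:
  assumes "norm x1 \<le> 1" "T \<ge> 0"
  obtains v where "v T = x1" "flow_line_on {0..T} J v"
proof -
  have "continuous_on UNIV (\<lambda>s. - J (max 0 (T - s)))"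
    by (intro continuous_on_minus cont_extended continuous_intros)
  from flow_line_exists[OF this _ assms(1)] norm_le
  obtain u where u: "u 0 = x1" "flow_line_on {0..} (\<lambda>s. - J (max 0 (T - s))) u" by auto
  have "flow_line_on {0..T} J (\<lambda>t. u (T - t))"
    unfolding flow_line_on_def
  proof (intro ballI conjI)
    fix t assume t: "t \<in> {0..T}"
    show "norm (u (T - t)) \<le> 1" using flow_line_onD(1)[OF u(2)] t by auto
    have "(u \<circ> (\<lambda>t. T - t) has_vector_derivative (-1) *\<^sub>R proj_perp (u (T - t)) (- J (max 0 (T - (T - t)))))
        (at t within {0..T})"
    proof (rule vector_diff_chain_within)
      show "((\<lambda>t. T - t) has_vector_derivative - 1) (at t within {0..T})"
        by (auto intro!: derivative_eq_intros)
      show "(u has_vector_derivative proj_perp (u (T - t)) (- J (max 0 (T - (T - t)))))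
          (at (T - t) within (-) T ` {0..T})"
        by (rule has_vector_derivative_within_subset[OF flow_line_onD(2)[OF u(2)]]) (use t in auto)
    qed
    then show "((\<lambda>t. u (T - t)) has_vector_derivative proj_perp (u (T - t)) (J t)) (at t within {0..T})"
      using t by (simp add: o_def proj_perp_def)
  qed
  then show ?thesis using that[of "\<lambda>t. u (T - t)"] u(1) by simp
qed

lemma eventually_close:
  assumes "e > 0"
  obtains T where "T \<ge> 0" "\<And>t. t \<ge> T \<Longrightarrow> norm (J t - j *\<^sub>R \<Omega>) < e"
proof -
  have "\<forall>\<^sub>F t in at_top. dist (J t) (j *\<^sub>R \<Omega>) < e" using lim assms by (rule tendstoD)
  then obtain T where "\<And>t. t \<ge> T \<Longrightarrow> dist (J t) (j *\<^sub>R \<Omega>) < e" by (auto simp: eventually_at_top_linorder)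
  then show ?thesis using that[of "max 0 T"] by (simp add: dist_norm)
qed

text \<open>The line that stays near \<open>- \<Omega>\<close> is the limit of the flow lines \<open>v n\<close> that are exactly at
  \<open>- \<Omega>\<close> at time \<open>n\<close>. Each of them has to spend all late times up to \<open>n\<close> in a small cap around
  \<open>- \<Omega>\<close>, since it could not have returned there; this passes to the limit.\<close>
lemma back_line_exists:
  obtains w where "flow_line_on {0..} J w" "norm (w 0) = 1" "(w \<longlongrightarrow> - \<Omega>) at_top"
proof -
  have "\<exists>v. v (real n) = - \<Omega> \<and> flow_line_on {0..real n} J v" for n
    using flow_line_ending_at[of "- \<Omega>" "real n"] norm_\<Omega> by auto
  then obtain v where v: "\<And>n. v n (real n) = - \<Omega>" "\<And>n. flow_line_on {0..real n} J (v n)" by metis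
  have "norm (v n 0) \<le> 1" for n using flow_line_onD(1)[OF v(2)] by simp
  then have "\<forall>n. v n 0 \<in> cball 0 1" by simp
  with compact_cball[of "0 :: real ^ 'n" 1] obtain x r
    where x: "x \<in> cball 0 1" "strict_mono r" "(((\<lambda>n. v n 0) \<circ> r) \<longlonglongrightarrow> x)"
    unfolding compact_def by metis
  have n1: "norm (v n 0) = 1" for n
  proof -
    have "1 - v n 0 \<bullet> v n 0 \<le> exp (2 * (real n - 0)) * (1 - v n n \<bullet> v n n)"
      by (rule gap_growth(2)[OF v(2) v(2)]) (use norm_le in auto)
    then have "v n 0 \<bullet> v n 0 \<ge> 1" using norm_\<Omega> by (simp add: v(1) power2_norm_eq_inner[symmetric])
    then have "norm (v n 0) \<ge> 1" by (simp add: norm_eq_sqrt_inner)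
    then show ?thesis using \<open>norm (v n 0) \<le> 1\<close> by simp
  qed
  have "(\<lambda>n. norm (((\<lambda>n. v n 0) \<circ> r) n)) \<longlonglongrightarrow> norm x" by (intro tendsto_norm x)
  then have "norm x = 1" by (simp add: n1 LIMSEQ_const_iff)
  obtain w where w: "w 0 = x" "flow_line_on {0..} J w" using flow_line_from[of x] x(1) by auto
  have conv: "(\<lambda>k. v (r k) t) \<longlonglongrightarrow> w t" if t: "t \<ge> 0" for t
  proof (rule tendsto_if_gap_tendsto_0)
    have "\<forall>\<^sub>F k in sequentially. nat \<lceil>t\<rceil> \<le> k" by (rule eventually_ge_at_top)
    then have ev: "\<forall>\<^sub>F k in sequentially. t \<le> real (r k)"
    proof eventually_elim
      case (elim k)
      then have "nat \<lceil>t\<rceil> \<le> r k" using seq_suble[OF x(2), of k] by simp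
      then show ?case by linarith
    qed
    then show "\<forall>\<^sub>F k in sequentially. norm (v (r k) t) \<le> 1"
      by eventually_elim (use flow_line_onD(1)[OF v(2)] t in auto)
    show nw: "norm (w t) \<le> 1" using flow_line_onD(1)[OF w(2)] t by simp
    show "(\<lambda>k. 1 - v (r k) t \<bullet> w t) \<longlonglongrightarrow> 0"
    proof (rule tendsto_sandwich[of "\<lambda>_. 0"])
      show "\<forall>\<^sub>F k in sequentially. 0 \<le> 1 - v (r k) t \<bullet> w t"
        using ev
      proof eventually_elim
        case (elim k)
        then show ?case using inner_le_one[OF _ nw, of "v (r k) t"] flow_line_onD(1)[OF v(2), of t "r k"] t by simp
      qed
      show "\<forall>\<^sub>F k in sequentially. 1 - v (r k) t \<bullet> w t \<le> exp (2 * (t - 0)) * (1 - v (r k) 0 \<bullet> w 0)"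
        using ev
      proof eventually_elim
        case (elim k)
        show ?case
          by (rule gap_growth(1)[of 0 t J]) (use elim t norm_le in \<open>auto intro: flow_line_on_subset[OF v(2)] flow_line_on_subset[OF w(2)]\<close>)
      qed
      have "(\<lambda>k. exp (2 * (t - 0)) * (1 - v (r k) 0 \<bullet> w 0)) \<longlonglongrightarrow> exp (2 * (t - 0)) * (1 - x \<bullet> w 0)"
        by (intro tendsto_intros) (use x(3) in \<open>simp add: o_def\<close>)
      then show "(\<lambda>k. exp (2 * (t - 0)) * (1 - v (r k) 0 \<bullet> w 0)) \<longlonglongrightarrow> 0"
        using \<open>norm x = 1\<close> by (simp add: w(1) power2_norm_eq_inner[symmetric])
    qed auto
  qed
  have in_cap: "\<forall>\<^sub>F t in at_top. 1 - w t \<bullet> (- \<Omega>) < e" if "e > 0" for e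
  proof -
    define \<epsilon> where "\<epsilon> = min 1 (e/2)"
    have \<epsilon>: "0 < \<epsilon>" "\<epsilon> \<le> 1" "\<epsilon> < e" using that by (auto simp: \<epsilon>_def)
    obtain T where T: "T \<ge> 0" "\<And>t. t \<ge> T \<Longrightarrow> norm (J t - j *\<^sub>R \<Omega>) < j * \<epsilon> / 2"
      using eventually_close[of "j * \<epsilon> / 2"] \<epsilon> j_pos by auto
    have "w t \<bullet> \<Omega> \<le> \<epsilon> - 1" if t: "t \<ge> T" for t
    proof (rule tendsto_upperbound)
      show "(\<lambda>k. v (r k) t \<bullet> \<Omega>) \<longlonglongrightarrow> w t \<bullet> \<Omega>"
        by (intro tendsto_intros conv) (use t T in simp)
      have "\<forall>\<^sub>F k in sequentially. nat \<lceil>t\<rceil> \<le> k" by (rule eventually_ge_at_top)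
      then show "\<forall>\<^sub>F k in sequentially. v (r k) t \<bullet> \<Omega> \<le> \<epsilon> - 1"
      proof eventually_elim
        case (elim k)
        then have "nat \<lceil>t\<rceil> \<le> r k" using seq_suble[OF x(2), of k] by simp
        then have k: "t \<le> real (r k)" by linarith
        show ?case
        proof (rule ccontr)
          assume "\<not> ?case"
          then have "v (r k) (r k) \<bullet> \<Omega> \<ge> \<epsilon> - 1"
            by (intro flow_line_leaves_back_cap[of t "r k" J "v (r k)" j \<Omega> \<epsilon>])
              (use k t T \<epsilon> j_pos norm_\<Omega> in \<open>auto intro: flow_line_on_subset[OF v(2)]\<close>)
          then show False using \<epsilon> norm_\<Omega> by (simp add: v(1) power2_norm_eq_inner[symmetric])
        qed
      qed
    qed auto
    then have "1 - w t \<bullet> (- \<Omega>) < e" if "t \<ge> T" for t using \<epsilon>(3) that by fastforce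
    then show ?thesis by (auto simp: eventually_at_top_linorder)
  qed
  have nw: "norm (w t) \<le> 1" if "t \<ge> 0" for t using flow_line_onD(1)[OF w(2)] that by simp
  have "(w \<longlongrightarrow> - \<Omega>) at_top"
  proof (rule tendsto_if_gap_tendsto_0)
    show nw': "\<forall>\<^sub>F t in at_top. norm (w t) \<le> 1"
      using nw by (auto simp: eventually_at_top_linorder)
    show "((\<lambda>t. 1 - w t \<bullet> - \<Omega>) \<longlongrightarrow> 0) at_top"
    proof (rule tendstoI)
      fix e :: real assume "e > 0"
      show "\<forall>\<^sub>F t in at_top. dist (1 - w t \<bullet> - \<Omega>) 0 < e"
        using in_cap[OF \<open>e > 0\<close>] nw'
      proof eventually_elim
        case (elim t)
        have "\<bar>w t \<bullet> \<Omega>\<bar> \<le> 1" using elim norm_\<Omega> by (intro inner_le_one) auto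
        then show ?case using elim by simp
      qed
    qed
  qed (use norm_\<Omega> in simp)
  then show ?thesis using that[of w] w \<open>norm x = 1\<close> by simp
qed

text \<open>Near \<open>- \<Omega>\<close> the gap of two flow lines increases. Being nonnegative and tending to \<open>0\<close>, it
  must vanish from some time on, and then at time \<open>0\<close> as well.\<close>
lemma back_line_unique:
  assumes v: "flow_line_on {0..} J v" "norm (v 0) = 1" "(v \<longlongrightarrow> - \<Omega>) at_top"
    and w: "flow_line_on {0..} J w" "norm (w 0) = 1" "(w \<longlongrightarrow> - \<Omega>) at_top"
  shows "v 0 = w 0"
proof -
  let ?D = "\<lambda>t. 1 - v t \<bullet> w t"
  have \<Omega>\<Omega>: "\<Omega> \<bullet> \<Omega> = 1" using norm_\<Omega> by (simp add: power2_norm_eq_inner[symmetric])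
  have n: "norm (v t) \<le> 1" "norm (w t) \<le> 1" if "t \<ge> 0" for t
    using flow_line_onD(1)[OF v(1)] flow_line_onD(1)[OF w(1)] that by auto
  have D0: "(?D \<longlongrightarrow> 1 - (- \<Omega>) \<bullet> (- \<Omega>)) at_top" by (intro tendsto_intros v w)
  have "((\<lambda>t. J t \<bullet> (v t + w t)) \<longlongrightarrow> (j *\<^sub>R \<Omega>) \<bullet> (- \<Omega> + - \<Omega>)) at_top"
    by (intro tendsto_intros v w lim)
  moreover have "(j *\<^sub>R \<Omega>) \<bullet> (- \<Omega> + - \<Omega>) < 0"
    unfolding inner_add_right using j_pos \<Omega>\<Omega> by simp
  ultimately have "\<forall>\<^sub>F t in at_top. J t \<bullet> (v t + w t) < 0" by (rule order_tendstoD)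
  then obtain T0 where T0: "\<And>t. t \<ge> T0 \<Longrightarrow> J t \<bullet> (v t + w t) < 0" by (auto simp: eventually_at_top_linorder)
  define T where "T = max 0 T0"
  have "?D T \<le> 0"
  proof (rule tendsto_lowerbound[OF D0[unfolded inner_minus_left inner_minus_right \<Omega>\<Omega>, simplified]])
    have "?D T \<le> ?D t" if "t \<ge> T" for t
    proof (rule interval_derivative_mono[OF that])
      fix s assume s: "T \<le> s" "s \<le> t"
      show "(?D has_real_derivative - (J s \<bullet> (v s + w s)) * ?D s) (at s within {T..t})"
        by (rule gap_derivative) (use s in \<open>auto simp: T_def intro: flow_line_on_subset[OF v(1)] flow_line_on_subset[OF w(1)]\<close>)
      have "s \<ge> 0" using s by (simp add: T_def)
      then show "0 \<le> - (J s \<bullet> (v s + w s)) * ?D s"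
        using T0[of s] s inner_le_one[OF n[of s]] by (intro mult_nonneg_nonneg) (auto simp: T_def intro: less_imp_le)
    qed
    then show "\<forall>\<^sub>F t in at_top. ?D T \<le> ?D t" by (auto simp: eventually_at_top_linorder)
  qed simp
  have "?D 0 \<le> exp (2 * (T - 0)) * ?D T"
    by (rule gap_growth(2)) (use norm_le in \<open>auto simp: T_def intro: flow_line_on_subset[OF v(1)] flow_line_on_subset[OF w(1)]\<close>)
  also have "\<dots> \<le> 0" using \<open>?D T \<le> 0\<close> by (simp add: mult_le_0_iff)
  finally have "2 * ?D 0 \<le> 0" by simp
  with norm_diff_le_gap[OF n[OF order_refl]] have "(norm (v 0 - w 0))\<^sup>2 \<le> 0" by (rule order_trans)
  then have "norm (v 0 - w 0) = 0" by (metis power2_less_eq_zero_iff)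
  then show ?thesis by simp
qed

text \<open>Since \<open>J\<close> is close to \<open>- j w\<close>, the gap \<open>D\<close> between \<open>y\<close> and \<open>w\<close> nearly satisfies the
  logistic equation \<open>D' = j D (2 - D)\<close>, so that a positive gap is driven to its maximal value \<open>2\<close>,
  which means \<open>y\<close> opposite to \<open>w\<close>. Its logarithm increases at rate at least \<open>j \<eta> / 4\<close> while
  \<open>D \<le> 2 - \<eta> / 2\<close>.\<close>
lemma front_line_tendsto:
  assumes w: "flow_line_on {0..} J w" "(w \<longlongrightarrow> - \<Omega>) at_top"
    and y: "flow_line_on {0..} J y" "y 0 \<bullet> w 0 < 1"
  shows "(y \<longlongrightarrow> \<Omega>) at_top"
proof -
  let ?D = "\<lambda>t. 1 - y t \<bullet> w t"
  have \<Omega>\<Omega>: "\<Omega> \<bullet> \<Omega> = 1" using norm_\<Omega> by (simp add: power2_norm_eq_inner[symmetric])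
  have n: "norm (y t) \<le> 1" "norm (w t) \<le> 1" if "t \<ge> 0" for t
    using flow_line_onD(1)[OF y(1)] flow_line_onD(1)[OF w(1)] that by auto
  have ge0: "\<forall>\<^sub>F t in at_top. t \<ge> (0::real)" by (rule eventually_ge_at_top)
  have Dpos: "?D t > 0" if "t \<ge> 0" for t
  proof -
    have "?D 0 \<le> exp (2 * (t - 0)) * ?D t"
      by (rule gap_growth(2)) (use norm_le that in \<open>auto intro: flow_line_on_subset[OF y(1)] flow_line_on_subset[OF w(1)]\<close>)
    then have "0 < exp (2 * (t - 0)) * ?D t" using y(2) by linarith
    then show ?thesis by (simp add: zero_less_mult_iff)
  qed
  (* e is the deviation of the logarithmic derivative of the gap from the logistic rate j (2 - D). *)
  define e where "e t = (J t + j *\<^sub>R w t) \<bullet> y t + (J t \<bullet> w t + j)" for t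
  have "((\<lambda>t. norm (J t + j *\<^sub>R w t) + \<bar>J t \<bullet> w t + j\<bar>) \<longlongrightarrow>
      norm (j *\<^sub>R \<Omega> + j *\<^sub>R (- \<Omega>)) + \<bar>(j *\<^sub>R \<Omega>) \<bullet> (- \<Omega>) + j\<bar>) at_top"
    by (intro tendsto_intros lim w)
  then have "((\<lambda>t. norm (J t + j *\<^sub>R w t) + \<bar>J t \<bullet> w t + j\<bar>) \<longlongrightarrow> 0) at_top"
    by (simp add: \<Omega>\<Omega>)
  then have e0: "\<forall>\<^sub>F t in at_top. norm (J t + j *\<^sub>R w t) + \<bar>J t \<bullet> w t + j\<bar> < a" if "a > 0" for a
    using that by (rule order_tendstoD)
  have "((\<lambda>t. 1 - y t \<bullet> (- w t)) \<longlongrightarrow> 0) at_top"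
  proof (rule tendstoI)
    fix \<eta> :: real assume "\<eta> > 0"
    have "\<forall>\<^sub>F t in at_top. 0 \<le> t \<and> norm (J t + j *\<^sub>R w t) + \<bar>J t \<bullet> w t + j\<bar> < j * \<eta> / 4"
      using e0[of "j * \<eta> / 4"] j_pos \<open>\<eta> > 0\<close> ge0 by (auto intro: eventually_conj)
    then obtain T where T: "\<And>t. t \<ge> T \<Longrightarrow> 0 \<le> t \<and> norm (J t + j *\<^sub>R w t) + \<bar>J t \<bullet> w t + j\<bar> < j * \<eta> / 4"
      by (auto simp: eventually_at_top_linorder)
    have T0: "T \<ge> 0" using T[of T] by simp
    show "\<forall>\<^sub>F t in at_top. dist (1 - y t \<bullet> (- w t)) 0 < \<eta>"
    (* For large \<eta> the level 2 - \<eta> / 2 is not positive and has no logarithm, but then the claim holds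
       since the gap lies between 0 and 2. *)
    proof (cases "\<eta> \<ge> 4")
      case True
      have "\<forall>t\<ge>T. dist (1 - y t \<bullet> (- w t)) 0 < \<eta>"
      proof (intro allI impI)
        fix t assume "t \<ge> T"
        then show "dist (1 - y t \<bullet> (- w t)) 0 < \<eta>" using inner_le_one[OF n[of t]] T[of t] True by auto
      qed
      then show ?thesis by (auto simp: eventually_at_top_linorder)
    next
      case False
      have "\<exists>T'\<ge>T. \<forall>t\<ge>T'. ln (?D t) \<ge> ln (2 - \<eta> / 2)"
      proof (rule eventually_exceeds)
        show "j * \<eta> / 4 > 0" using j_pos \<open>\<eta> > 0\<close> by simp
        fix t assume t: "T \<le> t"
        then have t0: "t \<ge> 0" and small: "norm (J t + j *\<^sub>R w t) + \<bar>J t \<bullet> w t + j\<bar> < j * \<eta> / 4"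
          using T by auto
        show "((\<lambda>t. ln (?D t)) has_real_derivative - (J t \<bullet> (y t + w t))) (at t within {T..})"
        proof -
          have "(?D has_real_derivative - (J t \<bullet> (y t + w t)) * ?D t) (at t within {T..})"
            by (rule gap_derivative) (use t T0 in \<open>auto intro: flow_line_on_subset[OF y(1)] flow_line_on_subset[OF w(1)]\<close>)
          then have "((\<lambda>t. ln (?D t)) has_real_derivative inverse (?D t) * (- (J t \<bullet> (y t + w t)) * ?D t)) (at t within {T..})"
            by (rule DERIV_chain2[where f = ln and g = ?D, OF DERIV_ln[OF Dpos[OF t0]]])
          moreover have "inverse d * (a * d) = a" if "d > 0" for a d :: real using that by simp
          ultimately show ?thesis using Dpos[OF t0] by metis
        qed
        assume "ln (?D t) \<le> ln (2 - \<eta> / 2)"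
        then have "?D t \<le> 2 - \<eta> / 2" using Dpos[OF t0] False by simp
        then have "j * (\<eta> / 2) \<le> j * (2 - ?D t)" using j_pos by (intro mult_left_mono) auto
        moreover have "J t \<bullet> (y t + w t) = e t - j * (2 - ?D t)"
          by (simp add: e_def inner_simps algebra_simps inner_commute)
        moreover have "e t \<le> norm (J t + j *\<^sub>R w t) + \<bar>J t \<bullet> w t + j\<bar>"
        proof -
          have "(J t + j *\<^sub>R w t) \<bullet> y t \<le> norm (J t + j *\<^sub>R w t) * norm (y t)" by (rule norm_cauchy_schwarz)
          also have "\<dots> \<le> norm (J t + j *\<^sub>R w t) * 1" using n[OF t0] by (intro mult_left_mono) auto
          finally show ?thesis by (simp add: e_def)
        qed
        ultimately show "- (J t \<bullet> (y t + w t)) \<ge> j * \<eta> / 4" using small by simp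
      qed
      then obtain T' where T': "T' \<ge> T" "\<And>t. t \<ge> T' \<Longrightarrow> ln (?D t) \<ge> ln (2 - \<eta> / 2)" by blast
      have "dist (1 - y t \<bullet> (- w t)) 0 < \<eta>" if "t \<ge> T'" for t
      proof -
        have "t \<ge> 0" using that T' T0 by simp
        have "2 - \<eta> / 2 \<le> ?D t" using T'(2)[OF that] Dpos[OF \<open>t \<ge> 0\<close>] False by simp
        then show ?thesis using inner_le_one[OF n[OF \<open>t \<ge> 0\<close>]] \<open>\<eta> > 0\<close> by simp
      qed
      then show ?thesis by (auto simp: eventually_at_top_linorder)
    qed
  qed
  then have gap: "((\<lambda>t. (norm (y t - (- w t)))\<^sup>2) \<longlongrightarrow> 0) at_top"
  proof (rule tendsto_sandwich[rotated 3, OF tendsto_mult_right_zero[of _ _ 2]])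
    show "\<forall>\<^sub>F t in at_top. (norm (y t - - w t))\<^sup>2 \<le> 2 * (1 - y t \<bullet> - w t)"
      using ge0 by eventually_elim (rule norm_diff_le_gap, use n in auto)
    show "((\<lambda>_. 0) \<longlongrightarrow> 0) at_top" by simp
  qed auto
  have "((\<lambda>t. sqrt ((norm (y t - (- w t)))\<^sup>2)) \<longlongrightarrow> sqrt 0) at_top" using gap by (rule tendsto_real_sqrt)
  then have "((\<lambda>t. y t + w t) \<longlongrightarrow> 0) at_top" by (simp add: tendsto_norm_zero_iff)
  from tendsto_diff[OF this w(2)] show ?thesis by simp
qed

end

section \<open>Integration against measures on the sphere\<close>

lemma space_sphere_prob:
  assumes "sphere_prob \<mu>"
  shows "space \<mu> = unit_sphere"
  using assms sets_eq_imp_space_eq[of \<mu> sphere_borel] by (simp add: sphere_prob_def space_restrict_space)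

lemma prob_space_sphere_prob: "sphere_prob \<mu> \<Longrightarrow> prob_space \<mu>"
  by (simp add: sphere_prob_def)

lemma sphere_prob_measurable:
  fixes \<phi> :: "real ^ 'n \<Rightarrow> 'b::topological_space"
  assumes "sphere_prob \<mu>" "continuous_on unit_sphere \<phi>"
  shows "\<phi> \<in> borel_measurable \<mu>"
proof -
  have "\<phi> \<in> borel_measurable sphere_borel"
    using assms(2) by (rule borel_measurable_continuous_on_restrict)
  moreover have "borel_measurable \<mu> = (borel_measurable sphere_borel :: (real ^ 'n \<Rightarrow> 'b) set)"
    by (rule measurable_cong_sets) (use assms(1) in \<open>auto simp: sphere_prob_def\<close>)
  ultimately show ?thesis by simp
qed

lemma sphere_prob_sets:
  assumes "sphere_prob \<mu>" "closed A"
  shows "A \<inter> unit_sphere \<in> sets \<mu>"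
  using assms by (auto simp: sphere_prob_def sets_restrict_space)

lemma sphere_prob_integrable:
  fixes \<phi> :: "real ^ 'n \<Rightarrow> 'b::{banach, second_countable_topology}"
  assumes "sphere_prob \<mu>" "continuous_on unit_sphere \<phi>"
  shows "integrable \<mu> \<phi>"
proof -
  interpret prob_space \<mu> using assms(1) by (rule prob_space_sphere_prob)
  have "compact (\<phi> ` unit_sphere)" by (rule compact_continuous_image[OF assms(2)]) simp
  then obtain B where "\<forall>x\<in>\<phi> ` unit_sphere. norm x \<le> B" by (meson bounded_iff compact_imp_bounded)
  then have "AE x in \<mu>. norm (\<phi> x) \<le> B"
    by (intro AE_I2) (auto simp: space_sphere_prob[OF assms(1)])
  then show ?thesis by (rule integrable_const_bound) (rule sphere_prob_measurable[OF assms])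
qed

lemma sphere_prob_integral_mono:
  fixes \<phi> \<psi> :: "real ^ 'n \<Rightarrow> real"
  assumes "sphere_prob \<mu>" "continuous_on unit_sphere \<phi>" "continuous_on unit_sphere \<psi>"
    and "\<And>v. v \<in> unit_sphere \<Longrightarrow> \<phi> v \<le> \<psi> v"
  shows "(LINT v|\<mu>. \<phi> v) \<le> (LINT v|\<mu>. \<psi> v)"
  using assms by (intro integral_mono sphere_prob_integrable) (auto simp: space_sphere_prob[OF assms(1)])

lemma sphere_prob_integral_const:
  assumes "sphere_prob \<mu>"
  shows "(LINT v|\<mu>. c) = (c::'b::{banach, second_countable_topology})"
  using prob_space.prob_space[OF prob_space_sphere_prob[OF assms]] by simp

lemma sphere_prob_integral_norm_le:
  fixes \<phi> :: "real ^ 'n \<Rightarrow> 'b::{banach, second_countable_topology}"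
  assumes "sphere_prob \<mu>" "continuous_on unit_sphere \<phi>"
    and "\<And>v. v \<in> unit_sphere \<Longrightarrow> norm (\<phi> v) \<le> B"
  shows "norm (LINT v|\<mu>. \<phi> v) \<le> B"
proof -
  have "norm (LINT v|\<mu>. \<phi> v) \<le> (LINT v|\<mu>. norm (\<phi> v))" by (rule integral_norm_bound)
  also have "\<dots> \<le> (LINT v|\<mu>. B)"
    by (rule sphere_prob_integral_mono[OF assms(1)]) (use assms in \<open>auto intro: continuous_intros\<close>)
  also have "\<dots> = B" by (rule sphere_prob_integral_const[OF assms(1)])
  finally show ?thesis .
qed

lemma sphere_prob_integral_diff_le:
  fixes \<phi> \<psi> :: "real ^ 'n \<Rightarrow> real"
  assumes "sphere_prob \<mu>" "continuous_on unit_sphere \<phi>" "continuous_on unit_sphere \<psi>"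
    and "\<And>v. v \<in> unit_sphere \<Longrightarrow> \<bar>\<phi> v - \<psi> v\<bar> \<le> e"
  shows "\<bar>(LINT v|\<mu>. \<phi> v) - (LINT v|\<mu>. \<psi> v)\<bar> \<le> e"
proof -
  have "(LINT v|\<mu>. \<phi> v) - (LINT v|\<mu>. \<psi> v) = (LINT v|\<mu>. \<phi> v - \<psi> v)"
    by (rule Bochner_Integration.integral_diff[symmetric]) (intro sphere_prob_integrable assms)+
  then show ?thesis
    using sphere_prob_integral_norm_le[OF assms(1), of "\<lambda>v. \<phi> v - \<psi> v" e] assms
    by (auto intro: continuous_intros)
qed

lemma first_moment_inner:
  assumes "sphere_prob \<mu>"
  shows "(LINT v|\<mu>. v \<bullet> e) = first_moment \<mu> \<bullet> e"
  unfolding first_moment_def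
  by (rule integral_inner_left) (intro sphere_prob_integrable assms continuous_intros)

lemma norm_first_moment_le:
  assumes "sphere_prob \<mu>"
  shows "norm (first_moment \<mu>) \<le> 1"
  unfolding first_moment_def
  by (rule sphere_prob_integral_norm_le[OF assms]) (auto intro: continuous_intros)

section \<open>Time-dependent test functions\<close>

lemma continuous_on_time_slice:
  assumes "continuous_on ({0..} \<times> S) (\<lambda>(t, v). \<Phi> t v)" "(t::real) \<ge> 0"
  shows "continuous_on S (\<Phi> t)"
proof -
  have "continuous_on S ((\<lambda>(t, v). \<Phi> t v) \<circ> (\<lambda>v. (t, v)))"
    by (rule continuous_on_compose)
      (auto intro!: continuous_intros continuous_on_subset[OF assms(1)] simp: assms(2))
  then show ?thesis by (simp add: o_def)
qed

lemma uniform_time_continuity: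
  fixes \<Phi> :: "real \<Rightarrow> real ^ 'n \<Rightarrow> real"
  assumes "continuous_on ({0..} \<times> unit_sphere) (\<lambda>(t, v). \<Phi> t v)" "t \<ge> 0" "e > 0"
  obtains d where "d > 0" "\<And>s v. s \<ge> 0 \<Longrightarrow> \<bar>s - t\<bar> < d \<Longrightarrow> v \<in> unit_sphere \<Longrightarrow> \<bar>\<Phi> s v - \<Phi> t v\<bar> < e"
proof -
  have "uniformly_continuous_on ({0..t + 1} \<times> unit_sphere) (\<lambda>(t, v). \<Phi> t v)"
    by (rule compact_uniformly_continuous)
      (auto intro!: compact_Times intro: continuous_on_subset[OF assms(1)])
  then obtain d where d: "d > 0" "\<And>p q. p \<in> {0..t + 1} \<times> unit_sphere \<Longrightarrow> q \<in> {0..t + 1} \<times> unit_sphere \<Longrightarrow>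
      dist q p < d \<Longrightarrow> dist (case q of (t, v) \<Rightarrow> \<Phi> t v) (case p of (t, v) \<Rightarrow> \<Phi> t v) < e"
    using \<open>e > 0\<close> unfolding uniformly_continuous_on_def by metis
  show ?thesis
  proof
    show "min d 1 > 0" using d by simp
    fix s v assume "s \<ge> 0" "\<bar>s - t\<bar> < min d 1" "v \<in> (unit_sphere :: (real ^ 'n) set)"
    then show "\<bar>\<Phi> s v - \<Phi> t v\<bar> < e"
      using d(2)[of "(t, v)" "(s, v)"] assms(2) by (auto simp: dist_Pair_Pair dist_real_def)
  qed
qed

lemma continuous_on_moving_integral:
  fixes \<Phi> :: "real \<Rightarrow> real ^ 'n \<Rightarrow> real"
  assumes f: "sphere_weakly_continuous f"
    and \<Phi>: "continuous_on ({0..} \<times> unit_sphere) (\<lambda>(t, v). \<Phi> t v)"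
  shows "continuous_on {0..} (\<lambda>t. LINT v|f t. \<Phi> t v)"
  unfolding continuous_on_iff
proof (intro ballI allI impI)
  fix t e :: real assume t: "t \<in> {0..}" and "e > 0"
  have sp: "sphere_prob (f s)" if "s \<ge> 0" for s using f that by (simp add: sphere_weakly_continuous_def)
  have slice: "continuous_on unit_sphere (\<Phi> s)" if "s \<ge> 0" for s
    using continuous_on_time_slice[OF \<Phi> that] .
  obtain d where d: "d > 0" "\<And>s v. s \<ge> 0 \<Longrightarrow> \<bar>s - t\<bar> < d \<Longrightarrow> v \<in> unit_sphere \<Longrightarrow> \<bar>\<Phi> s v - \<Phi> t v\<bar> < e / 2"
    using uniform_time_continuity[OF \<Phi>, of t "e/2"] t \<open>e > 0\<close> by auto
  have "continuous_on {0..} (\<lambda>s. LINT v|f s. \<Phi> t v)"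
    using f slice[of t] t by (simp add: sphere_weakly_continuous_def)
  then obtain d' where d': "d' > 0" "\<And>s. s \<in> {0..} \<Longrightarrow> dist s t < d' \<Longrightarrow>
      dist (LINT v|f s. \<Phi> t v) (LINT v|f t. \<Phi> t v) < e / 2"
    unfolding continuous_on_iff using t \<open>e > 0\<close> by (metis half_gt_zero)
  show "\<exists>d>0. \<forall>s\<in>{0..}. dist s t < d \<longrightarrow> dist (LINT v|f s. \<Phi> s v) (LINT v|f t. \<Phi> t v) < e"
  proof (intro exI[of _ "min d d'"] conjI ballI impI)
    fix s :: real assume s: "s \<in> {0..}" "dist s t < min d d'"
    have "\<bar>(LINT v|f s. \<Phi> s v) - (LINT v|f s. \<Phi> t v)\<bar> \<le> e / 2"
      by (rule sphere_prob_integral_diff_le)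
        (use s t d(2)[of s] in \<open>auto intro: sp slice less_imp_le simp: dist_real_def\<close>)
    moreover have "\<bar>(LINT v|f s. \<Phi> t v) - (LINT v|f t. \<Phi> t v)\<bar> < e / 2"
      using d'(2)[of s] s by (simp add: dist_real_def)
    ultimately show "dist (LINT v|f s. \<Phi> s v) (LINT v|f t. \<Phi> t v) < e"
      unfolding dist_real_def by linarith
  qed (use d d' in auto)
qed

text \<open>The weak equation extends to test functions that move with time. The increment of the integral
  splits into the change of the test function, integrated against the later measure, and the change of the
  measure with the test function kept at time \<open>t\<close>. The second part is the weak equation; in the first, the
  difference quotients converge uniformly on the compact sphere, so that weak continuity of \<open>f\<close> yields the
  limit.\<close>
lemma transport_derivative:
  fixes \<Phi> \<Phi>' :: "real \<Rightarrow> real ^ 'n \<Rightarrow> real" and G :: "real \<Rightarrow> real ^ 'n \<Rightarrow> real ^ 'n"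
  assumes sol: "aggregation_solution f0 f"
    and time: "\<And>t v. t \<ge> 0 \<Longrightarrow> v \<in> unit_sphere \<Longrightarrow> ((\<lambda>s. \<Phi> s v) has_real_derivative \<Phi>' t v) (at t within {0..})"
    and time_cont: "continuous_on ({0..} \<times> unit_sphere) (\<lambda>(t, v). \<Phi>' t v)"
    and grad: "\<And>t v. t \<ge> 0 \<Longrightarrow> v \<in> unit_sphere \<Longrightarrow> (\<Phi> t has_derivative (\<lambda>h. G t v \<bullet> h)) (at v)"
    and grad_cont: "\<And>t. t \<ge> 0 \<Longrightarrow> continuous_on unit_sphere (G t)"
    and t: "t \<ge> 0"
  shows "((\<lambda>s. LINT v|f s. \<Phi> s v) has_real_derivative
    (LINT v|f t. \<Phi>' t v + proj_perp v (first_moment (f t)) \<bullet> G t v)) (at t within {0..})"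
proof -
  have wc: "sphere_weakly_continuous f" using sol by (simp add: aggregation_solution_def)
  have sp: "sphere_prob (f s)" if "s \<ge> 0" for s using wc that by (simp add: sphere_weakly_continuous_def)
  have \<Phi>_cont: "continuous_on unit_sphere (\<Phi> s)" if "s \<ge> 0" for s
    using grad[OF that] by (meson continuous_at_imp_continuous_on has_derivative_continuous)
  have \<Phi>'_cont: "continuous_on unit_sphere (\<Phi>' s)" if "s \<ge> 0" for s
    using continuous_on_time_slice[OF time_cont that] .
  have perp_cont: "continuous_on unit_sphere (\<lambda>v. proj_perp v (G t v))"
    unfolding proj_perp_def by (intro continuous_intros grad_cont t)
  have sg: "sphere_grad (\<Phi> t) v = proj_perp v (G t v)" if "v \<in> unit_sphere" for v
    by (rule sphere_grad_eq[OF that has_sphere_grad_ambient[OF that grad[OF t that]]])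
  have "C1_sphere (\<Phi> t)"
    unfolding C1_sphere_def
  proof (intro conjI ballI)
    show "continuous_on unit_sphere (sphere_grad (\<Phi> t))"
      using perp_cont by (rule continuous_on_cong[THEN iffD1, rotated 2]) (auto simp: sg)
  qed (use has_sphere_grad_ambient grad t in blast)
  then have "((\<lambda>s. LINT v|f s. \<Phi> t v) has_real_derivative
      (LINT v|f t. first_moment (f t) \<bullet> sphere_grad (\<Phi> t) v)) (at t within {0..})"
    using sol t by (simp add: aggregation_solution_def)
  moreover have "(LINT v|f t. first_moment (f t) \<bullet> sphere_grad (\<Phi> t) v)
      = (LINT v|f t. proj_perp v (first_moment (f t)) \<bullet> G t v)"
    by (rule Bochner_Integration.integral_cong)
      (auto simp: space_sphere_prob[OF sp[OF t]] sg proj_perp_def inner_simps inner_commute algebra_simps)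
  ultimately have space_part: "((\<lambda>s. ((LINT v|f s. \<Phi> t v) - (LINT v|f t. \<Phi> t v)) / (s - t)) \<longlongrightarrow>
      (LINT v|f t. proj_perp v (first_moment (f t)) \<bullet> G t v)) (at t within {0..})"
    by (simp add: has_field_derivative_iff)
  have time_part: "((\<lambda>s. (LINT v|f s. (\<Phi> s v - \<Phi> t v) / (s - t))) \<longlongrightarrow> (LINT v|f t. \<Phi>' t v)) (at t within {0..})"
  proof (rule Lim_transform2)
    have "continuous_on {0..} (\<lambda>s. LINT v|f s. \<Phi>' t v)"
      using wc \<Phi>'_cont[OF t] by (simp add: sphere_weakly_continuous_def)
    then show "((\<lambda>s. LINT v|f s. \<Phi>' t v) \<longlongrightarrow> (LINT v|f t. \<Phi>' t v)) (at t within {0..})"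
      using t by (simp add: continuous_on_def)
    show "((\<lambda>s. (LINT v|f s. \<Phi>' t v) - (LINT v|f s. (\<Phi> s v - \<Phi> t v) / (s - t))) \<longlongrightarrow> 0) (at t within {0..})"
      unfolding tendsto_iff eventually_at
    proof (intro allI impI)
      fix e :: real assume "e > 0"
      obtain d where d: "d > 0" "\<And>s v. s \<ge> 0 \<Longrightarrow> \<bar>s - t\<bar> < d \<Longrightarrow> v \<in> unit_sphere \<Longrightarrow> \<bar>\<Phi>' s v - \<Phi>' t v\<bar> < e / 2"
        using uniform_time_continuity[OF time_cont t, of "e/2"] \<open>e > 0\<close> by auto
      show "\<exists>d>0. \<forall>s\<in>{0..}. s \<noteq> t \<and> dist s t < d \<longrightarrow>
          dist ((LINT v|f s. \<Phi>' t v) - (LINT v|f s. (\<Phi> s v - \<Phi> t v) / (s - t))) 0 < e"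
      proof (intro exI[of _ d] conjI ballI impI)
        fix s :: real assume s: "s \<in> {0..}" "s \<noteq> t \<and> dist s t < d"
        have bound: "\<bar>\<Phi>' t v - (\<Phi> s v - \<Phi> t v) / (s - t)\<bar> \<le> e / 2" if v: "v \<in> unit_sphere" for v
        proof -
          let ?C = "{0..} \<inter> ball t d"
          have "norm ((\<Phi> s v - s * \<Phi>' t v) - (\<Phi> t v - t * \<Phi>' t v)) \<le> e / 2 * norm (s - t)"
          proof (rule field_differentiable_bound[of ?C])
            show "convex ?C" by (intro convex_Int) auto
            show "s \<in> ?C" "t \<in> ?C" using s t d(1) by (auto simp: dist_commute)
            fix z assume z: "z \<in> ?C"
            have "((\<lambda>s. \<Phi> s v) has_real_derivative \<Phi>' z v) (at z within ?C)"
              by (rule has_field_derivative_subset[OF time]) (use z v in auto)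
            then show "((\<lambda>s. \<Phi> s v - s * \<Phi>' t v) has_real_derivative \<Phi>' z v - \<Phi>' t v) (at z within ?C)"
              by (auto intro!: derivative_eq_intros)
            show "norm (\<Phi>' z v - \<Phi>' t v) \<le> e / 2"
              using d(2)[of z v] z v by (auto simp: dist_real_def abs_minus_commute)
          qed
          moreover have "(\<Phi> s v - \<Phi> t v) / (s - t) - \<Phi>' t v =
              ((\<Phi> s v - s * \<Phi>' t v) - (\<Phi> t v - t * \<Phi>' t v)) / (s - t)"
            using s by (simp add: field_simps)
          ultimately have "\<bar>(\<Phi> s v - \<Phi> t v) / (s - t) - \<Phi>' t v\<bar> \<le> e / 2"
            using s by (simp add: divide_le_eq abs_divide)
          then show ?thesis by (simp only: abs_minus_commute)
        qed
        have "\<bar>(LINT v|f s. \<Phi>' t v) - (LINT v|f s. (\<Phi> s v - \<Phi> t v) / (s - t))\<bar> \<le> e / 2"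
          by (rule sphere_prob_integral_diff_le) (use s t bound in \<open>auto intro!: sp \<Phi>_cont \<Phi>'_cont continuous_intros\<close>)
        then show "dist ((LINT v|f s. \<Phi>' t v) - (LINT v|f s. (\<Phi> s v - \<Phi> t v) / (s - t))) 0 < e"
          using \<open>e > 0\<close> by simp
      qed (rule d)
    qed
  qed
  have "((\<lambda>s. (LINT v|f s. (\<Phi> s v - \<Phi> t v) / (s - t)) + ((LINT v|f s. \<Phi> t v) - (LINT v|f t. \<Phi> t v)) / (s - t)) \<longlongrightarrow>
      (LINT v|f t. \<Phi>' t v) + (LINT v|f t. proj_perp v (first_moment (f t)) \<bullet> G t v)) (at t within {0..})"
    by (rule tendsto_add[OF time_part space_part])
  also have "(LINT v|f t. \<Phi>' t v) + (LINT v|f t. proj_perp v (first_moment (f t)) \<bullet> G t v)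
      = (LINT v|f t. \<Phi>' t v + proj_perp v (first_moment (f t)) \<bullet> G t v)"
    by (rule Bochner_Integration.integral_add[symmetric])
      (auto intro!: sphere_prob_integrable sp t \<Phi>'_cont continuous_intros grad_cont simp: proj_perp_def)
  finally have "((\<lambda>s. (LINT v|f s. (\<Phi> s v - \<Phi> t v) / (s - t)) + ((LINT v|f s. \<Phi> t v) - (LINT v|f t. \<Phi> t v)) / (s - t)) \<longlongrightarrow>
      (LINT v|f t. \<Phi>' t v + proj_perp v (first_moment (f t)) \<bullet> G t v)) (at t within {0..})" .
  then show ?thesis
    unfolding has_field_derivative_iff
  proof (rule Lim_transform_eventually)
    show "\<forall>\<^sub>F s in at t within {0..}. (LINT v|f s. (\<Phi> s v - \<Phi> t v) / (s - t)) + ((LINT v|f s. \<Phi> t v) - (LINT v|f t. \<Phi> t v)) / (s - t)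
        = ((LINT v|f s. \<Phi> s v) - (LINT v|f t. \<Phi> t v)) / (s - t)"
      unfolding eventually_at
    proof (intro exI[of _ 1] conjI ballI impI)
      fix s :: real assume s: "s \<in> {0..}" "s \<noteq> t \<and> dist s t < 1"
      have "(LINT v|f s. (\<Phi> s v - \<Phi> t v) / (s - t)) = ((LINT v|f s. \<Phi> s v) - (LINT v|f s. \<Phi> t v)) / (s - t)"
        using s t by (simp add: Bochner_Integration.integral_diff sphere_prob_integrable sp \<Phi>_cont)
      then show "(LINT v|f s. (\<Phi> s v - \<Phi> t v) / (s - t)) + ((LINT v|f s. \<Phi> t v) - (LINT v|f t. \<Phi> t v)) / (s - t)
        = ((LINT v|f s. \<Phi> s v) - (LINT v|f t. \<Phi> t v)) / (s - t)"
        by (simp only: add_divide_distrib[symmetric]) simp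
    qed simp
  qed
qed

section \<open>Estimates behind the convergence of the first moment\<close>

lemma le_if_le_plus_multiple:
  fixes x y c :: real
  assumes "\<And>e. e > 0 \<Longrightarrow> x \<le> y + e * c" "c > 0"
  shows "x \<le> y"
proof (rule field_le_epsilon)
  fix e :: real assume "e > 0"
  then show "x \<le> y + e" using assms(1)[of "e / c"] \<open>c > 0\<close> by simp
qed

text \<open>The function \<open>K\<close> is automatically nondecreasing; bounded, it satisfies the Cauchy condition, which
  \<open>J\<close> inherits.\<close>
lemma converges_if_increments_dominated:
  fixes J :: "real \<Rightarrow> 'a::banach" and K :: "real \<Rightarrow> real"
  assumes dom: "\<And>s t. 0 \<le> s \<Longrightarrow> s \<le> t \<Longrightarrow> norm (J t - J s) \<le> K t - K s"
    and bound: "\<And>t. t \<ge> 0 \<Longrightarrow> K t \<le> B"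
  obtains L where "(J \<longlongrightarrow> L) at_top"
proof -
  have small: "\<exists>T\<ge>0. \<forall>s\<ge>T. \<forall>t\<ge>s. norm (J t - J s) < e" if "e > 0" for e
  proof -
    define k where "k = Sup (K ` {0..})"
    have bdd: "bdd_above (K ` {0..})" using bound by (auto intro!: bdd_aboveI[of _ B])
    have "\<exists>x\<in>K ` {0..}. k - e < x"
      unfolding k_def by (rule less_cSupD) (use that in auto)
    then obtain T where T: "T \<ge> 0" "k - e < K T" by auto
    have "norm (J t - J s) < e" if "s \<ge> T" "t \<ge> s" for s t
    proof -
      have "K t \<le> k" unfolding k_def by (rule cSup_upper[OF _ bdd]) (use that T in auto)
      moreover have "K T \<le> K s" using dom[of T s] that T norm_ge_zero[of "J s - J T"] by linarith
      moreover have "norm (J t - J s) \<le> K t - K s" using dom that T by simp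
      ultimately show ?thesis using T by linarith
    qed
    then show ?thesis using T by blast
  qed
  have "Cauchy (\<lambda>n. J (real n))"
  proof (rule metric_CauchyI)
    fix e :: real assume "e > 0"
    then obtain T where T: "\<And>s t. s \<ge> T \<Longrightarrow> t \<ge> s \<Longrightarrow> norm (J t - J s) < e" using small by blast
    have "dist (J (real m)) (J (real n)) < e" if "m \<ge> nat \<lceil>T\<rceil>" "n \<ge> nat \<lceil>T\<rceil>" for m n
    proof (cases "m \<le> n")
      case True
      then show ?thesis using T[of "real m" "real n"] that by (simp add: dist_norm norm_minus_commute nat_le_iff ceiling_le_iff)
    next
      case False
      then show ?thesis using T[of "real n" "real m"] that by (simp add: dist_norm nat_le_iff ceiling_le_iff)
    qed
    then show "\<exists>M. \<forall>m\<ge>M. \<forall>n\<ge>M. dist (J (real m)) (J (real n)) < e" by blast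
  qed
  then obtain L where L: "(\<lambda>n. J (real n)) \<longlonglongrightarrow> L"
    using Cauchy_convergent_iff convergent_def by blast
  have "(J \<longlongrightarrow> L) at_top"
  proof (rule tendstoI)
    fix e :: real assume "e > 0"
    then obtain T where T: "\<And>s t. s \<ge> T \<Longrightarrow> t \<ge> s \<Longrightarrow> norm (J t - J s) < e / 2" using small[of "e/2"] by auto
    have "\<forall>\<^sub>F n in sequentially. dist (J (real n)) L < e / 2"
      using tendstoD[OF L] \<open>e > 0\<close> half_gt_zero by blast
    then have "\<forall>\<^sub>F n in sequentially. dist (J (real n)) L < e / 2 \<and> n \<ge> nat \<lceil>T\<rceil>"
      by (rule eventually_conj) (rule eventually_ge_at_top)
    then obtain n where n: "dist (J (real n)) L < e / 2" "n \<ge> nat \<lceil>T\<rceil>"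
      using eventually_happens'[OF sequentially_bot] by blast
    have "dist (J t) L < e" if "t \<ge> real n" for t
    proof -
      have "norm (J t - J (real n)) < e / 2" using T[of "real n" t] n(2) that by (simp add: nat_le_iff ceiling_le_iff)
      then show ?thesis using n(1) dist_triangle[of "J t" L "J (real n)"] by (simp add: dist_norm)
    qed
    then show "\<forall>\<^sub>F t in at_top. dist (J t) L < e" by (auto simp: eventually_at_top_linorder)
  qed
  then show ?thesis using that by blast
qed

text \<open>Split \<open>v\<close> into its component along \<open>a\<close> and the rest \<open>r\<close>. The first contributes a multiple of
  \<open>a \<bullet> u\<close>; the second has \<open>|r|\<^sup>2 = 1 - (v \<bullet> a)\<^sup>2 / |a|\<^sup>2\<close>, which is small when \<open>v\<close> is
  nearly parallel to \<open>a\<close>. With \<open>a = J\<close> and \<open>u = J'\<close> both terms are controlled by the spread.\<close>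
lemma inner_square_split_bound:
  fixes v a u :: "'a::real_inner"
  assumes "norm v = 1" "a \<noteq> 0"
  shows "(v \<bullet> u)\<^sup>2 \<le> 2 * (a \<bullet> u)\<^sup>2 / (a \<bullet> a) + 2 * (a \<bullet> a - (v \<bullet> a)\<^sup>2) * (u \<bullet> u) / (a \<bullet> a)"
proof -
  define p where "p = (v \<bullet> a) / (a \<bullet> a)"
  define r where "r = v - p *\<^sub>R a"
  have aa: "a \<bullet> a > 0" using assms by simp
  have vv: "v \<bullet> v = 1" using assms by (simp add: power2_norm_eq_inner[symmetric])
  have pa: "p * (a \<bullet> a) = v \<bullet> a" using aa by (simp add: p_def)
  have rr: "r \<bullet> r = (a \<bullet> a - (v \<bullet> a)\<^sup>2) / (a \<bullet> a)"
  proof -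
    have "r \<bullet> r = 1 - 2 * p * (v \<bullet> a) + p * (p * (a \<bullet> a))"
      by (simp add: r_def inner_simps vv inner_commute[of a v] algebra_simps)
    also have "\<dots> = 1 - (v \<bullet> a) * (v \<bullet> a) / (a \<bullet> a)" unfolding pa by (simp add: p_def)
    finally show ?thesis using aa by (simp add: power2_eq_square diff_divide_distrib)
  qed
  have "(v \<bullet> a)\<^sup>2 \<le> a \<bullet> a" using Cauchy_Schwarz_ineq[of v a] vv by simp
  then have "p\<^sup>2 \<le> 1 / (a \<bullet> a)"
    using aa by (simp add: p_def power_divide power2_eq_square[of "a \<bullet> a"] field_simps)
  then have "p\<^sup>2 * (a \<bullet> u)\<^sup>2 \<le> 1 / (a \<bullet> a) * (a \<bullet> u)\<^sup>2" by (intro mult_right_mono) auto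
  moreover have "(r \<bullet> u)\<^sup>2 \<le> (a \<bullet> a - (v \<bullet> a)\<^sup>2) / (a \<bullet> a) * (u \<bullet> u)"
    using Cauchy_Schwarz_ineq[of r u] rr by simp
  moreover have "(v \<bullet> u)\<^sup>2 \<le> 2 * (p\<^sup>2 * (a \<bullet> u)\<^sup>2) + 2 * (r \<bullet> u)\<^sup>2"
  proof -
    have "v \<bullet> u = p * (a \<bullet> u) + r \<bullet> u" by (simp add: r_def inner_simps)
    then show ?thesis
      using zero_le_power2[of "p * (a \<bullet> u) - r \<bullet> u"]
      by (simp add: power2_eq_square algebra_simps)
  qed
  moreover have "2 * (a \<bullet> u)\<^sup>2 / (a \<bullet> a) = 2 * (1 / (a \<bullet> a) * (a \<bullet> u)\<^sup>2)"
    "2 * (a \<bullet> a - (v \<bullet> a)\<^sup>2) * (u \<bullet> u) / (a \<bullet> a) = 2 * ((a \<bullet> a - (v \<bullet> a)\<^sup>2) / (a \<bullet> a) * (u \<bullet> u))"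
    by simp_all
  ultimately show ?thesis by linarith
qed

section \<open>Convergence of the first moment\<close>

locale aggregation =
  fixes f0 :: "(real ^ 'n) measure" and f :: "real \<Rightarrow> (real ^ 'n) measure"
  assumes solution: "aggregation_solution f0 f"
    and first_moment_start: "first_moment (f 0) \<noteq> 0"
begin

abbreviation J :: "real \<Rightarrow> real ^ 'n" where "J t \<equiv> first_moment (f t)"

definition J' :: "real \<Rightarrow> real ^ 'n" where "J' t = (LINT v|f t. proj_perp v (J t))"

text \<open>Differentiating \<open>\<integral> proj_perp v (J t) df\<close> gives several cubic terms; after integration they
  combine into this form, in which the integrand of the spread appears as a factor.\<close>
definition J'' :: "real \<Rightarrow> real ^ 'n"
  where "J'' t = (LINT v|f t. proj_perp v (J' t) - (2 * (J t \<bullet> J t - (v \<bullet> J t)\<^sup>2)) *\<^sub>R v)"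

lemma weakly_continuous: "sphere_weakly_continuous f"
  using solution by (simp add: aggregation_solution_def)

lemma sphere_prob: "t \<ge> 0 \<Longrightarrow> sphere_prob (f t)"
  using weakly_continuous by (simp add: sphere_weakly_continuous_def)

lemma integral_inner_commute:
  fixes \<psi> :: "real ^ 'n \<Rightarrow> real ^ 'n"
  assumes "t \<ge> 0" "continuous_on unit_sphere \<psi>"
  shows "(LINT v|f t. \<psi> v) \<bullet> e = (LINT v|f t. \<psi> v \<bullet> e)"
  by (rule integral_inner_left[symmetric]) (intro sphere_prob_integrable sphere_prob assms)

lemma J'_inner: "t \<ge> 0 \<Longrightarrow> J' t \<bullet> e = (LINT v|f t. proj_perp v (J t) \<bullet> e)"
  unfolding J'_def by (rule integral_inner_commute) (auto simp: proj_perp_def intro!: continuous_intros)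

lemma vector_derivative_componentwise:
  fixes g :: "real \<Rightarrow> real ^ 'n"
  assumes "\<And>e. ((\<lambda>s. g s \<bullet> e) has_real_derivative g' \<bullet> e) (at t within S)"
  shows "(g has_vector_derivative g') (at t within S)"
  unfolding has_vector_derivative_def
proof (subst has_derivative_componentwise_within, intro ballI)
  fix e :: "real ^ 'n"
  show "((\<lambda>s. g s \<bullet> e) has_derivative (\<lambda>h. (h *\<^sub>R g') \<bullet> e)) (at t within S)"
    using assms[of e] unfolding has_field_derivative_def
    by (rule has_derivative_eq_rhs) (simp add: fun_eq_iff)
qed

lemma J_derivative:
  assumes t: "t \<ge> 0"
  shows "(J has_vector_derivative J' t) (at t within {0..})"
proof (rule vector_derivative_componentwise)
  fix e
  have "((\<lambda>s. LINT v|f s. v \<bullet> e) has_real_derivative (LINT v|f t. 0 + proj_perp v (J t) \<bullet> e)) (at t within {0..})"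
    by (rule transport_derivative[OF solution _ _ _ _ t])
      (auto intro!: derivative_eq_intros continuous_intros simp: case_prod_unfold inner_commute)
  then have "((\<lambda>s. LINT v|f s. v \<bullet> e) has_real_derivative J' t \<bullet> e) (at t within {0..})"
    using J'_inner[OF t] by simp
  then show "((\<lambda>s. J s \<bullet> e) has_real_derivative J' t \<bullet> e) (at t within {0..})"
    by (rule has_field_derivative_transform_within[OF _ zero_less_one])
      (use t in \<open>auto simp: first_moment_inner sphere_prob\<close>)
qed

lemma J_cont: "continuous_on {0..} J"
  by (rule continuous_on_vector_derivative[OF J_derivative]) auto

lemma J_norm_le: "t \<ge> 0 \<Longrightarrow> norm (J t) \<le> 1"
  by (rule norm_first_moment_le[OF sphere_prob])

lemma J'_cont: "continuous_on {0..} J'"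
proof (subst continuous_on_componentwise, intro ballI)
  fix e :: "real ^ 'n"
  have "continuous_on {0..} (\<lambda>t. LINT v|f t. proj_perp v (J t) \<bullet> e)"
    by (rule continuous_on_moving_integral[OF weakly_continuous])
      (auto simp: proj_perp_def case_prod_unfold intro!: continuous_intros continuous_on_compose2[OF J_cont])
  then show "continuous_on {0..} (\<lambda>t. J' t \<bullet> e)"
    by (rule continuous_on_cong[THEN iffD1, rotated 2]) (auto simp: J'_inner)
qed

lemma J'_derivative:
  assumes t: "t \<ge> 0"
  shows "(J' has_vector_derivative J'' t) (at t within {0..})"
proof (rule vector_derivative_componentwise)
  fix e
  define \<Phi> where "\<Phi> s v = proj_perp v (J s) \<bullet> e" for s v
  define \<Phi>' where "\<Phi>' s v = J' s \<bullet> e - (v \<bullet> J' s) * (v \<bullet> e)" for s v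
  define G where "G s v = - (v \<bullet> e) *\<^sub>R J s - (v \<bullet> J s) *\<^sub>R e" for s v
  have \<Phi>: "\<Phi> s v = J s \<bullet> e - (v \<bullet> J s) * (v \<bullet> e)" for s v
    by (simp add: \<Phi>_def proj_perp_def inner_simps)
  have "((\<lambda>s. LINT v|f s. \<Phi> s v) has_real_derivative (LINT v|f t. \<Phi>' t v + proj_perp v (J t) \<bullet> G t v)) (at t within {0..})"
  proof (rule transport_derivative[OF solution _ _ _ _ t])
    fix s :: real and v :: "real ^ 'n" assume "s \<ge> 0" "v \<in> unit_sphere"
    have "((\<lambda>s. J s \<bullet> a) has_real_derivative J' s \<bullet> a) (at s within {0..})" for a
      unfolding has_real_derivative_iff_has_vector_derivative
      by (rule bounded_linear.has_vector_derivative[OF bounded_linear_inner_left J_derivative[OF \<open>s \<ge> 0\<close>]])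
    from this[of e] this[of v] show "((\<lambda>s. \<Phi> s v) has_real_derivative \<Phi>' s v) (at s within {0..})"
      unfolding \<Phi> \<Phi>'_def inner_commute[of v "J _"] inner_commute[of v "J' _"]
      by (auto intro!: derivative_eq_intros)
    show "(\<Phi> s has_derivative (\<lambda>h. G s v \<bullet> h)) (at v)"
      unfolding \<Phi>[abs_def] G_def
      by (auto intro!: derivative_eq_intros simp: inner_simps algebra_simps inner_commute)
  qed (auto simp: \<Phi>'_def[abs_def] G_def[abs_def] case_prod_unfold intro!: continuous_intros continuous_on_compose2[OF J'_cont])
  moreover have "(LINT v|f t. \<Phi>' t v + proj_perp v (J t) \<bullet> G t v) = J'' t \<bullet> e"
  proof -
    (* ?A is the integrand of the claimed derivative; the remainder ?B integrates to zero by the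
       definition of the first moment. *)
    let ?A = "\<lambda>v. (proj_perp v (J' t) - (2 * (J t \<bullet> J t - (v \<bullet> J t)\<^sup>2)) *\<^sub>R v) \<bullet> e"
    let ?B = "\<lambda>v. (J t \<bullet> J t) * (v \<bullet> e) - (v \<bullet> J t) * (J t \<bullet> e)"
    have "(LINT v|f t. \<Phi>' t v + proj_perp v (J t) \<bullet> G t v) = (LINT v|f t. ?A v + ?B v)"
      by (rule Bochner_Integration.integral_cong)
        (auto simp: \<Phi>'_def G_def proj_perp_def inner_simps algebra_simps power2_eq_square inner_commute)
    also have "\<dots> = (LINT v|f t. ?A v) + (LINT v|f t. ?B v)"
      by (rule Bochner_Integration.integral_add)
        (auto intro!: sphere_prob_integrable sphere_prob t continuous_intros simp: proj_perp_def)
    also have "(LINT v|f t. ?A v) = J'' t \<bullet> e"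
      unfolding J''_def
      by (rule integral_inner_commute[OF t, symmetric]) (auto intro!: continuous_intros simp: proj_perp_def)
    also have "(LINT v|f t. ?B v) = (LINT v|f t. (J t \<bullet> J t) * (v \<bullet> e)) - (LINT v|f t. (v \<bullet> J t) * (J t \<bullet> e))"
      by (rule Bochner_Integration.integral_diff)
        (auto intro!: sphere_prob_integrable sphere_prob t continuous_intros)
    also have "\<dots> = 0"
      by (simp add: first_moment_inner sphere_prob t)
    finally show ?thesis by simp
  qed
  ultimately have "((\<lambda>s. LINT v|f s. \<Phi> s v) has_real_derivative J'' t \<bullet> e) (at t within {0..})" by simp
  then show "((\<lambda>s. J' s \<bullet> e) has_real_derivative J'' t \<bullet> e) (at t within {0..})"
    by (rule has_field_derivative_transform_within[OF _ zero_less_one])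
      (use t in \<open>auto simp: J'_inner \<Phi>_def\<close>)
qed

text \<open>Up to the factor \<open>|J|\<^sup>2\<close>, this is the mean of the squared sine of the angle between \<open>v\<close> and the
  first moment.\<close>
definition spread :: "real \<Rightarrow> real" where "spread t = (LINT v|f t. J t \<bullet> J t - (v \<bullet> J t)\<^sup>2)"

lemma variance_integrand_nonneg:
  assumes "v \<in> unit_sphere"
  shows "0 \<le> a \<bullet> a - (v \<bullet> a)\<^sup>2"
  using Cauchy_Schwarz_ineq[of v a] assms by (simp add: power2_norm_eq_inner[symmetric])

lemma J_inner_J': "t \<ge> 0 \<Longrightarrow> J t \<bullet> J' t = spread t"
  unfolding spread_def
  by (subst inner_commute, subst J'_inner, simp, rule Bochner_Integration.integral_cong)
    (auto simp: proj_perp_def inner_simps power2_eq_square inner_commute)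

lemma spread_nonneg: "t \<ge> 0 \<Longrightarrow> spread t \<ge> 0"
  unfolding spread_def by (rule integral_nonneg_AE, rule AE_I2)
    (use variance_integrand_nonneg in \<open>auto simp: space_sphere_prob[OF sphere_prob]\<close>)

lemma J'_norm_le: "t \<ge> 0 \<Longrightarrow> norm (J' t) \<le> 1"
  unfolding J'_def
proof (rule sphere_prob_integral_norm_le[OF sphere_prob])
  fix v :: "real ^ 'n" assume t: "t \<ge> 0" and v: "v \<in> unit_sphere"
  have "v \<bullet> v = 1" using v by (simp add: power2_norm_eq_inner[symmetric])
  then have "(norm (proj_perp v (J t)))\<^sup>2 = (norm (J t))\<^sup>2 - (v \<bullet> J t)\<^sup>2"
    unfolding power2_norm_eq_inner
    by (simp add: proj_perp_def inner_simps power2_eq_square inner_commute algebra_simps)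
  also have "\<dots> \<le> 1" using J_norm_le[OF t] by (smt (verit) norm_ge_zero power_le_one zero_le_power2)
  finally show "norm (proj_perp v (J t)) \<le> 1" by (simp add: power_le_one_iff)
qed (auto simp: proj_perp_def intro!: continuous_intros)

lemma J_square_derivative:
  assumes "t \<ge> 0"
  shows "((\<lambda>t. J t \<bullet> J t) has_real_derivative 2 * spread t) (at t within {0..})"
  using bounded_bilinear.has_vector_derivative[OF bounded_bilinear_inner J_derivative[OF assms] J_derivative[OF assms]]
  by (simp add: has_real_derivative_iff_has_vector_derivative J_inner_J'[OF assms] inner_commute[of "J' t"])

lemma norm_J_mono:
  assumes "0 \<le> s" "s \<le> t"
  shows "norm (J s) \<le> norm (J t)"
proof -
  have "J s \<bullet> J s \<le> J t \<bullet> J t"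
  proof (rule interval_derivative_mono[OF \<open>s \<le> t\<close>])
    fix x assume x: "s \<le> x" "x \<le> t"
    show "((\<lambda>t. J t \<bullet> J t) has_real_derivative 2 * spread x) (at x within {s..t})"
      by (rule has_field_derivative_subset[OF J_square_derivative]) (use x assms in auto)
    show "0 \<le> 2 * spread x" using spread_nonneg[of x] x assms by simp
  qed
  then show ?thesis by (simp add: norm_le)
qed

lemma J_nonzero: "t \<ge> 0 \<Longrightarrow> J t \<noteq> 0"
  using norm_J_mono[of 0 t] first_moment_start by auto

definition spread_factor :: real where "spread_factor = 4 / (norm (J 0))\<^sup>2 + 2"

text \<open>The term \<open>|J'|\<^sup>2\<close> comes from the identity part of \<open>J'' = J' - S J' - \<dots>\<close>. All other terms
  carry the spread: the cubic one by definition, and \<open>J' \<bullet> S J'\<close> by splitting \<open>v\<close> along \<open>J\<close>. The spread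
  itself is at most \<open>|J'|\<close>, which turns its square into spread times \<open>|J'|\<close>, and \<open>|J| \<ge> |J 0|\<close>
  bounds the denominators.\<close>
lemma J'_inner_J''_ge:
  assumes t: "t \<ge> 0"
  shows "J' t \<bullet> J'' t \<ge> (norm (J' t))\<^sup>2 - spread_factor * spread t * norm (J' t)"
proof -
  let ?j = "J t \<bullet> J t" and ?u = "J' t \<bullet> J' t" and ?n = "norm (J' t)"
  have j: "?j > 0" using J_nonzero[OF t] by simp
  have Gn: "spread t \<ge> 0" by (rule spread_nonneg[OF t])
  have "?u - (2 * (spread t)\<^sup>2 / ?j + 2 * spread t * ?u / ?j) - 2 * spread t * ?n
      = (LINT v|f t. ?u - (2 * (spread t)\<^sup>2 / ?j + 2 * (?j - (v \<bullet> J t)\<^sup>2) * ?u / ?j) - 2 * (?j - (v \<bullet> J t)\<^sup>2) * ?n)"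
  proof -
    have i: "integrable (f t) (\<lambda>v. ?j - (v \<bullet> J t)\<^sup>2)"
      by (auto intro!: sphere_prob_integrable sphere_prob t continuous_intros)
    have "(LINT v|f t. ?u - (2 * (spread t)\<^sup>2 / ?j + 2 * (?j - (v \<bullet> J t)\<^sup>2) * ?u / ?j) - 2 * (?j - (v \<bullet> J t)\<^sup>2) * ?n)
        = (LINT v|f t. (?u - 2 * (spread t)\<^sup>2 / ?j) - (2 * ?u / ?j + 2 * ?n) * (?j - (v \<bullet> J t)\<^sup>2))"
      by (rule Bochner_Integration.integral_cong) (auto simp: algebra_simps)
    also have "\<dots> = (LINT v|f t. ?u - 2 * (spread t)\<^sup>2 / ?j) - (LINT v|f t. (2 * ?u / ?j + 2 * ?n) * (?j - (v \<bullet> J t)\<^sup>2))"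
      by (rule Bochner_Integration.integral_diff) (intro sphere_prob_integrable sphere_prob t continuous_intros)+
    also have "\<dots> = (?u - 2 * (spread t)\<^sup>2 / ?j) - (2 * ?u / ?j + 2 * ?n) * spread t"
      unfolding spread_def[of t] sphere_prob_integral_const[OF sphere_prob[OF t]] by simp
    finally show ?thesis by (simp add: algebra_simps)
  qed
  also have "\<dots> \<le> (LINT v|f t. (proj_perp v (J' t) - (2 * (?j - (v \<bullet> J t)\<^sup>2)) *\<^sub>R v) \<bullet> J' t)"
  proof (rule sphere_prob_integral_mono[OF sphere_prob[OF t]])
    fix v :: "real ^ 'n" assume v: "v \<in> unit_sphere"
    have "(v \<bullet> J' t)\<^sup>2 \<le> 2 * (spread t)\<^sup>2 / ?j + 2 * (?j - (v \<bullet> J t)\<^sup>2) * ?u / ?j"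
      using inner_square_split_bound[of v "J t" "J' t"] v J_nonzero[OF t] J_inner_J'[OF t] by simp
    moreover have "(2 * (?j - (v \<bullet> J t)\<^sup>2)) * (v \<bullet> J' t) \<le> (2 * (?j - (v \<bullet> J t)\<^sup>2)) * ?n"
      using variance_integrand_nonneg[OF v, of "J t"] norm_cauchy_schwarz[of v "J' t"] v
      by (intro mult_left_mono) auto
    moreover have "(proj_perp v (J' t) - (2 * (?j - (v \<bullet> J t)\<^sup>2)) *\<^sub>R v) \<bullet> J' t =
        ?u - (v \<bullet> J' t)\<^sup>2 - (2 * (?j - (v \<bullet> J t)\<^sup>2)) * (v \<bullet> J' t)"
      by (simp add: proj_perp_def inner_simps power2_eq_square)
    ultimately show "?u - (2 * (spread t)\<^sup>2 / ?j + 2 * (?j - (v \<bullet> J t)\<^sup>2) * ?u / ?j) - 2 * (?j - (v \<bullet> J t)\<^sup>2) * ?n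
        \<le> (proj_perp v (J' t) - (2 * (?j - (v \<bullet> J t)\<^sup>2)) *\<^sub>R v) \<bullet> J' t"
      by linarith
  qed (use j in \<open>auto simp: proj_perp_def intro!: continuous_intros\<close>)
  also have "\<dots> = J' t \<bullet> J'' t"
    unfolding J''_def inner_commute[of "J' t" "LINT v|_. _ v"]
    by (rule integral_inner_commute[OF t, symmetric]) (auto intro!: continuous_intros simp: proj_perp_def)
  finally have "?u - (2 * (spread t)\<^sup>2 / ?j + 2 * spread t * ?u / ?j) - 2 * spread t * ?n \<le> J' t \<bullet> J'' t" .
  moreover have "2 * (spread t)\<^sup>2 / ?j + 2 * spread t * ?u / ?j \<le> 4 / (norm (J 0))\<^sup>2 * (spread t * ?n)"
  proof -
    have "spread t \<le> norm (J t) * ?n" unfolding J_inner_J'[OF t, symmetric] by (rule norm_cauchy_schwarz)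
    also have "\<dots> \<le> 1 * ?n" by (intro mult_right_mono J_norm_le t) auto
    finally have "spread t * spread t \<le> spread t * ?n" using Gn by (intro mult_left_mono) auto
    moreover have "spread t * ?u \<le> spread t * ?n"
    proof (rule mult_left_mono[OF _ Gn])
      have "?u = ?n * ?n" by (simp add: power2_norm_eq_inner[symmetric] power2_eq_square)
      also have "\<dots> \<le> 1 * ?n" by (intro mult_right_mono J'_norm_le t) auto
      finally show "?u \<le> ?n" by simp
    qed
    ultimately have "(2 * (spread t)\<^sup>2 + 2 * spread t * ?u) / ?j \<le> (4 * (spread t * ?n)) / ?j"
      using j by (intro divide_right_mono) (auto simp: power2_eq_square)
    also have "\<dots> \<le> (4 * (spread t * ?n)) / (norm (J 0))\<^sup>2"
    proof (rule divide_left_mono)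
      show "(norm (J 0))\<^sup>2 \<le> ?j"
        unfolding power2_norm_eq_inner[symmetric] using norm_J_mono[of 0 t] t by (intro power_mono) auto
    qed (use Gn first_moment_start j in auto)
    finally show ?thesis by (simp add: add_divide_distrib)
  qed
  ultimately show ?thesis by (simp add: spread_factor_def power2_norm_eq_inner algebra_simps)
qed

text \<open>Heuristically \<open>|J'|' \<ge> |J'| - C spread\<close>, and \<open>spread\<close> is half the derivative of \<open>|J|\<^sup>2\<close>; hence
  \<open>|J'|\<close> is at most the derivative of \<open>|J'| + C |J|\<^sup>2 / 2\<close>. As \<open>|J'|\<close> need not be differentiable
  where it vanishes, it is replaced by \<open>sqrt (|J'|\<^sup>2 + \<epsilon>\<^sup>2)\<close>, at the cost of an extra slope
  \<open>\<epsilon>\<close>.\<close>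
lemma J_increment_bound:
  assumes "0 \<le> s" "s \<le> t"
  shows "norm (J t - J s) \<le> (norm (J' t) + spread_factor / 2 * (J t \<bullet> J t)) - (norm (J' s) + spread_factor / 2 * (J s \<bullet> J s))"
proof (cases "s = t")
  case False
  then have "s < t" using assms by simp
  show ?thesis
  proof (rule le_if_le_plus_multiple)
    fix \<epsilon> :: real assume \<epsilon>: "\<epsilon> > 0"
    define H where "H x = sqrt (J' x \<bullet> J' x + \<epsilon>\<^sup>2)" for x
    define \<phi> where "\<phi> x = H x + spread_factor / 2 * (J x \<bullet> J x) + \<epsilon> * x" for x
    define \<phi>' where "\<phi>' x = (J' x \<bullet> J'' x) / H x + spread_factor * spread x + \<epsilon>" for x
    have pos: "J' x \<bullet> J' x + \<epsilon>\<^sup>2 > 0" for x using \<epsilon> by (simp add: add_nonneg_pos)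
    have Hsq: "H x * H x = (norm (J' x))\<^sup>2 + \<epsilon>\<^sup>2" for x
      using pos[of x] by (simp add: H_def power2_norm_eq_inner less_imp_le)
    have Hn: "norm (J' x) \<le> H x" for x
      unfolding H_def norm_eq_sqrt_inner by (rule real_sqrt_le_mono) simp
    have H\<epsilon>: "\<epsilon> \<le> H x" for x
      unfolding H_def by (rule real_le_rsqrt) simp
    have d\<phi>: "(\<phi> has_real_derivative \<phi>' x) (at x within {0..})" if "x \<ge> 0" for x
    proof -
      have "((\<lambda>x. J' x \<bullet> J' x) has_real_derivative J' x \<bullet> J'' x + J'' x \<bullet> J' x) (at x within {0..})"
        unfolding has_real_derivative_iff_has_vector_derivative
        by (rule bounded_bilinear.has_vector_derivative[OF bounded_bilinear_inner J'_derivative[OF that] J'_derivative[OF that]])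
      then have "((\<lambda>x. J' x \<bullet> J' x + \<epsilon>\<^sup>2) has_real_derivative 2 * (J' x \<bullet> J'' x)) (at x within {0..})"
        by (auto intro!: derivative_eq_intros simp: inner_commute)
      then have "(H has_real_derivative (inverse (H x) / 2) * (2 * (J' x \<bullet> J'' x))) (at x within {0..})"
        unfolding H_def[abs_def]
        by (rule DERIV_chain2[where f = sqrt and g = "\<lambda>x. J' x \<bullet> J' x + \<epsilon>\<^sup>2", OF DERIV_real_sqrt[OF pos]])
      then show ?thesis
        unfolding \<phi>_def[abs_def] \<phi>'_def
        by (auto intro!: derivative_eq_intros J_square_derivative[OF that] simp: field_simps)
    qed
    have "norm (J t - J s) \<le> \<phi> t - \<phi> s"
    proof (rule differentiable_bound_general[OF \<open>s < t\<close>])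
      show "continuous_on {s..t} J" by (rule continuous_on_subset[OF J_cont]) (use assms in auto)
      have "continuous_on {0..} \<phi>" by (rule DERIV_continuous_on[OF d\<phi>]) simp
      then show "continuous_on {s..t} \<phi>" by (rule continuous_on_subset) (use assms in auto)
      fix x assume x: "s < x" "x < t"
      have x0: "x > 0" using x assms by simp
      have at: "at x within {0..} = at x" by (rule at_within_interior) (use x0 in simp)
      show "(J has_vector_derivative J' x) (at x)" using J_derivative[of x] x0 at by simp
      show "(\<phi> has_vector_derivative \<phi>' x) (at x)"
        using d\<phi>[of x] x0 at by (simp add: has_real_derivative_iff_has_vector_derivative)
      have Hp: "H x > 0" using H\<epsilon>[of x] \<epsilon> by simp
      have GC: "spread_factor * spread x \<ge> 0" using spread_nonneg[of x] x0 by (simp add: spread_factor_def)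
      have "(norm (J' x) - \<epsilon> - spread_factor * spread x) * H x \<le> (norm (J' x))\<^sup>2 - spread_factor * spread x * norm (J' x)"
      proof -
        have "norm (J' x) * H x \<le> H x * H x" using Hn[of x] Hp by (intro mult_right_mono) auto
        moreover have "\<epsilon> * \<epsilon> \<le> \<epsilon> * H x" using H\<epsilon>[of x] \<epsilon> by (intro mult_left_mono) auto
        moreover have "spread_factor * spread x * norm (J' x) \<le> spread_factor * spread x * H x" using Hn[of x] GC by (intro mult_left_mono) auto
        ultimately show ?thesis using Hsq[of x] by (simp add: algebra_simps power2_eq_square)
      qed
      also have "\<dots> \<le> J' x \<bullet> J'' x" using J'_inner_J''_ge[of x] x0 by simp
      finally have "norm (J' x) - \<epsilon> - spread_factor * spread x \<le> (J' x \<bullet> J'' x) / H x" using Hp by (simp add: pos_le_divide_eq)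
      then show "norm (J' x) \<le> \<phi>' x" by (simp add: \<phi>'_def)
    qed
    also have "\<dots> \<le> (norm (J' t) + spread_factor / 2 * (J t \<bullet> J t)) - (norm (J' s) + spread_factor / 2 * (J s \<bullet> J s)) + \<epsilon> * (1 + t - s)"
    proof -
      have "H t \<le> norm (J' t) + \<epsilon>"
        unfolding H_def using \<epsilon> by (intro real_le_lsqrt) (auto simp: power2_sum power2_norm_eq_inner[symmetric])
      then show ?thesis using Hn[of s] by (simp add: \<phi>_def algebra_simps)
    qed
    finally show "norm (J t - J s) \<le> (norm (J' t) + spread_factor / 2 * (J t \<bullet> J t)) - (norm (J' s) + spread_factor / 2 * (J s \<bullet> J s)) + \<epsilon> * (1 + t - s)" .
  qed (use assms in simp)
qed simp

lemma J_convergent: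
  obtains L where "(J \<longlongrightarrow> L) at_top" "L \<noteq> 0"
proof -
  obtain L where L: "(J \<longlongrightarrow> L) at_top"
  proof (rule converges_if_increments_dominated[OF J_increment_bound])
    fix t :: real assume t: "t \<ge> 0"
    have "J t \<bullet> J t \<le> 1"
      using J_norm_le[OF t] by (simp add: power2_norm_eq_inner[symmetric] power_le_one)
    then have "spread_factor / 2 * (J t \<bullet> J t) \<le> spread_factor / 2 * 1" by (intro mult_left_mono) (auto simp: spread_factor_def)
    then show "norm (J' t) + spread_factor / 2 * (J t \<bullet> J t) \<le> 1 + spread_factor / 2" using J'_norm_le[OF t] by simp
  qed
  have "norm (J 0) \<le> norm L"
    by (rule tendsto_lowerbound[OF tendsto_norm[OF L]])
      (auto simp: eventually_at_top_linorder intro!: exI[of _ 0] norm_J_mono)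
  then have "L \<noteq> 0" using first_moment_start by auto
  with L show ?thesis by (rule that)
qed

end

section \<open>A conserved cross-ratio\<close>

text \<open>With the reference curves \<open>y\<close> in the open ball and \<open>w\<close> on the sphere this is a cross-ratio of gaps.
  The normalisation is chosen such that \<open>y = 0\<close> gives the plain gap \<open>1 - v \<bullet> w\<close>.\<close>
definition cross_ratio :: "real ^ 'n \<Rightarrow> real ^ 'n \<Rightarrow> real ^ 'n \<Rightarrow> real"
  where "cross_ratio y w v = (1 - y \<bullet> y) / (1 - y \<bullet> w) * ((1 - v \<bullet> w) / (1 - v \<bullet> y))"

lemma inner_less_one:
  fixes v y :: "'a::real_inner"
  assumes "norm v \<le> 1" "norm y < 1"
  shows "v \<bullet> y < 1"
proof -
  have "v \<bullet> y \<le> norm v * norm y" by (rule norm_cauchy_schwarz)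
  also have "\<dots> \<le> 1 * norm y" using assms by (intro mult_right_mono) auto
  finally show ?thesis using assms by simp
qed

lemma cross_ratio_nonneg:
  assumes "norm y < 1" "norm w \<le> 1" "norm v \<le> 1"
  shows "cross_ratio y w v \<ge> 0"
  using inner_less_one[of y y] inner_less_one[of w y] inner_less_one[of v y] inner_le_one[of v w] assms
  by (auto simp: cross_ratio_def inner_commute[of y w])

lemma cross_ratio_cont:
  assumes "norm y < 1"
  shows "continuous_on unit_sphere (cross_ratio y w)"
proof -
  have "1 - v \<bullet> y \<noteq> 0" if "v \<in> unit_sphere" for v using inner_less_one[of v y] that assms by simp
  then show ?thesis unfolding cross_ratio_def[abs_def] by (intro continuous_intros) auto
qed

lemma cross_ratio_eq_0_iff:
  assumes "norm y < 1" "norm w = 1" "v \<in> unit_sphere"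
  shows "cross_ratio y w v = 0 \<longleftrightarrow> v = w"
proof -
  have "y \<bullet> y < 1" "y \<bullet> w < 1" "v \<bullet> y < 1"
    using assms inner_less_one[of y y] inner_less_one[of w y] inner_less_one[of v y]
    by (auto simp: inner_commute)
  then have "cross_ratio y w v = 0 \<longleftrightarrow> 1 - v \<bullet> w = 0" by (simp add: cross_ratio_def)
  also have "\<dots> \<longleftrightarrow> v = w"
    using norm_diff_le_gap[of v w] assms by (auto simp: power2_norm_eq_inner[symmetric])
  finally show ?thesis .
qed

text \<open>The factor that does not involve \<open>v\<close> has logarithmic derivative \<open>J \<bullet> (w - y)\<close>, by the equation for
  the two gaps of which it is the quotient.\<close>
lemma cross_ratio_time_derivative:
  assumes y: "flow_line_on S J y" and w: "flow_line_on S J w" and "t \<in> S"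
    and ny: "norm (y t) < 1" and "norm v \<le> 1"
  shows "((\<lambda>s. cross_ratio (y s) (w s) v) has_real_derivative
    (1 - y t \<bullet> y t) / (1 - y t \<bullet> w t) * ((J t \<bullet> (w t - y t)) * ((1 - v \<bullet> w t) / (1 - v \<bullet> y t))
      - (v \<bullet> proj_perp (w t) (J t)) / (1 - v \<bullet> y t)
      + (1 - v \<bullet> w t) * (v \<bullet> proj_perp (y t) (J t)) / (1 - v \<bullet> y t)\<^sup>2)) (at t within S)"
proof -
  have nw: "norm (w t) \<le> 1" using flow_line_onD(1)[OF w \<open>t \<in> S\<close>] .
  have nz: "1 - y t \<bullet> y t \<noteq> 0" "1 - y t \<bullet> w t \<noteq> 0" "1 - v \<bullet> y t \<noteq> 0"
    using inner_less_one[of "y t" "y t"] inner_less_one[of "w t" "y t"] inner_less_one[of v "y t"] ny nw assms(5)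
    by (auto simp: inner_commute)
  have gap: "((\<lambda>s. 1 - v \<bullet> u s) has_real_derivative - (v \<bullet> proj_perp (u t) (J t))) (at t within S)"
    if "flow_line_on S J u" for u
  proof -
    have "((\<lambda>s. v \<bullet> u s) has_real_derivative v \<bullet> proj_perp (u t) (J t)) (at t within S)"
      unfolding has_real_derivative_iff_has_vector_derivative
      by (rule bounded_linear.has_vector_derivative[OF bounded_linear_inner_right flow_line_onD(2)[OF that \<open>t \<in> S\<close>]])
    then show ?thesis by (auto intro!: derivative_eq_intros)
  qed
  have "((\<lambda>s. (1 - y s \<bullet> y s) / (1 - y s \<bullet> w s)) has_real_derivative
      (- (J t \<bullet> (y t + y t)) * (1 - y t \<bullet> y t) * (1 - y t \<bullet> w t)
        - (1 - y t \<bullet> y t) * (- (J t \<bullet> (y t + w t)) * (1 - y t \<bullet> w t)))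
      / ((1 - y t \<bullet> w t) * (1 - y t \<bullet> w t))) (at t within S)"
    by (rule DERIV_divide[OF gap_derivative[OF y y \<open>t \<in> S\<close>] gap_derivative[OF y w \<open>t \<in> S\<close>] nz(2)])
  also have "(- (J t \<bullet> (y t + y t)) * (1 - y t \<bullet> y t) * (1 - y t \<bullet> w t)
        - (1 - y t \<bullet> y t) * (- (J t \<bullet> (y t + w t)) * (1 - y t \<bullet> w t)))
      / ((1 - y t \<bullet> w t) * (1 - y t \<bullet> w t)) = (1 - y t \<bullet> y t) / (1 - y t \<bullet> w t) * (J t \<bullet> (w t - y t))"
    unfolding inner_add_right inner_diff_right using nz(2)
    by (simp add: divide_simps) (simp add: algebra_simps)
  finally have "((\<lambda>s. (1 - y s \<bullet> y s) / (1 - y s \<bullet> w s)) has_real_derivative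
      (1 - y t \<bullet> y t) / (1 - y t \<bullet> w t) * (J t \<bullet> (w t - y t))) (at t within S)" .
  from DERIV_mult'[OF this DERIV_divide[OF gap[OF w] gap[OF y] nz(3)]]
  show ?thesis
    unfolding cross_ratio_def
  proof (rule DERIV_cong)
    define A where "A = (1 - y t \<bullet> y t) / (1 - y t \<bullet> w t)"
    define p q where "p = 1 - v \<bullet> w t" and "q = 1 - v \<bullet> y t"
    have "q \<noteq> 0" using nz by (simp add: q_def)
    then show "(1 - y t \<bullet> y t) / (1 - y t \<bullet> w t) *
        ((- (v \<bullet> proj_perp (w t) (J t)) * (1 - v \<bullet> y t) - (1 - v \<bullet> w t) * - (v \<bullet> proj_perp (y t) (J t))) /
          ((1 - v \<bullet> y t) * (1 - v \<bullet> y t))) +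
      (1 - y t \<bullet> y t) / (1 - y t \<bullet> w t) * (J t \<bullet> (w t - y t)) * ((1 - v \<bullet> w t) / (1 - v \<bullet> y t)) =
      (1 - y t \<bullet> y t) / (1 - y t \<bullet> w t) * ((J t \<bullet> (w t - y t)) * ((1 - v \<bullet> w t) / (1 - v \<bullet> y t))
      - (v \<bullet> proj_perp (w t) (J t)) / (1 - v \<bullet> y t)
      + (1 - v \<bullet> w t) * (v \<bullet> proj_perp (y t) (J t)) / (1 - v \<bullet> y t)\<^sup>2)"
      unfolding A_def[symmetric] p_def[symmetric] q_def[symmetric]
      by (simp add: divide_simps) (simp add: algebra_simps power2_eq_square)
  qed
qed

lemma cross_ratio_space_derivative:
  assumes "1 - v \<bullet> y \<noteq> 0"
  shows "(cross_ratio y w has_derivative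
    (\<lambda>h. ((1 - y \<bullet> y) / (1 - y \<bullet> w)) *\<^sub>R (((1 - v \<bullet> w) / (1 - v \<bullet> y)\<^sup>2) *\<^sub>R y - (1 / (1 - v \<bullet> y)) *\<^sub>R w) \<bullet> h)) (at v)"
proof -
  have "((\<lambda>v. (1 - v \<bullet> w) / (1 - v \<bullet> y)) has_derivative
      (\<lambda>h. (- (h \<bullet> w) * (1 - v \<bullet> y) - (1 - v \<bullet> w) * - (h \<bullet> y)) / ((1 - v \<bullet> y) * (1 - v \<bullet> y)))) (at v)"
    by (rule has_derivative_divide'[where f = "\<lambda>v. 1 - v \<bullet> w" and g = "\<lambda>v. 1 - v \<bullet> y", OF _ _ assms]) (auto intro!: derivative_eq_intros)
  then have "(cross_ratio y w has_derivative (\<lambda>h. (1 - y \<bullet> y) / (1 - y \<bullet> w) *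
      ((- (h \<bullet> w) * (1 - v \<bullet> y) - (1 - v \<bullet> w) * - (h \<bullet> y)) / ((1 - v \<bullet> y) * (1 - v \<bullet> y))))) (at v)"
    unfolding cross_ratio_def[abs_def] by (rule has_derivative_mult_right)
  then show ?thesis
  proof (rule has_derivative_eq_rhs, intro ext)
    fix h
    have quotient: "(- a * q - p * - b) / (q * q) = p / q\<^sup>2 * b - 1 / q * a" if "q \<noteq> 0" for a b p q :: real
      using that by (simp add: field_simps power2_eq_square)
    define A where "A = (1 - y \<bullet> y) / (1 - y \<bullet> w)"
    define q where "q = 1 - v \<bullet> y"
    have "q \<noteq> 0" using assms by (simp add: q_def)
    then show "(1 - y \<bullet> y) / (1 - y \<bullet> w) *
        ((- (h \<bullet> w) * (1 - v \<bullet> y) - (1 - v \<bullet> w) * - (h \<bullet> y)) / ((1 - v \<bullet> y) * (1 - v \<bullet> y))) =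
      ((1 - y \<bullet> y) / (1 - y \<bullet> w)) *\<^sub>R (((1 - v \<bullet> w) / (1 - v \<bullet> y)\<^sup>2) *\<^sub>R y - (1 / (1 - v \<bullet> y)) *\<^sub>R w) \<bullet> h"
      unfolding A_def[symmetric] q_def[symmetric] inner_scaleR_left inner_diff_left inner_commute[of w h] inner_commute[of y h]
      using quotient[OF \<open>q \<noteq> 0\<close>] by simp
  qed
qed

text \<open>Conservation along the flow: the time derivative of the cross-ratio and its derivative in the
  direction \<open>proj_perp v a\<close> cancel, up to the common factor \<open>(1 - y \<bullet> y) / (1 - y \<bullet> w)\<close>.\<close>
lemma cross_ratio_transport:
  assumes "1 - v \<bullet> y \<noteq> 0"
  shows "(a \<bullet> (w - y)) * ((1 - v \<bullet> w) / (1 - v \<bullet> y)) - (v \<bullet> proj_perp w a) / (1 - v \<bullet> y)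
      + (1 - v \<bullet> w) * (v \<bullet> proj_perp y a) / (1 - v \<bullet> y)\<^sup>2
      + proj_perp v a \<bullet> (((1 - v \<bullet> w) / (1 - v \<bullet> y)\<^sup>2) *\<^sub>R y - (1 / (1 - v \<bullet> y)) *\<^sub>R w) = 0"
proof -
  define q where "q = 1 - v \<bullet> y"
  have "q \<noteq> 0" using assms by (simp add: q_def)
  have vy: "v \<bullet> y = 1 - q" by (simp add: q_def)
  show ?thesis
    unfolding q_def[symmetric] proj_perp_def inner_diff_left inner_diff_right inner_scaleR_left inner_scaleR_right
      inner_commute[of y v] inner_commute[of w v] inner_commute[of y a] inner_commute[of w a] inner_commute[of v a] vy
    using \<open>q \<noteq> 0\<close> by (simp add: divide_simps power2_eq_square) (simp add: algebra_simps)
qed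

section \<open>Atoms and two-point measures\<close>

text \<open>The functions \<open>exp (- n r)\<close> decrease to the indicator of the zero of \<open>r\<close>. Unlike
  the indicator they are smooth whenever \<open>r\<close> is, and then admissible in the weak equation.\<close>
lemma laplace_tendsto_atom:
  fixes r :: "real ^ 'n \<Rightarrow> real"
  assumes \<mu>: "sphere_prob \<mu>" and r: "continuous_on unit_sphere r" "\<And>v. v \<in> unit_sphere \<Longrightarrow> r v \<ge> 0"
    and zero: "\<And>v. v \<in> unit_sphere \<Longrightarrow> r v = 0 \<longleftrightarrow> v = w" and w: "w \<in> unit_sphere"
  shows "(\<lambda>n. LINT v|\<mu>. exp (- (real n * r v))) \<longlonglongrightarrow> measure \<mu> {w}"
proof -
  interpret prob_space \<mu> using \<mu> by (rule prob_space_sphere_prob)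
  have ws: "{w} \<in> sets \<mu>" using sphere_prob_sets[OF \<mu>, of "{w}"] w by simp
  have "(\<lambda>n. LINT v|\<mu>. exp (- (real n * r v))) \<longlonglongrightarrow> (LINT v|\<mu>. indicat_real {w} v)"
  proof (rule integral_dominated_convergence[where w = "\<lambda>_. 1"])
    show "indicat_real {w} \<in> borel_measurable \<mu>" using ws by simp
    show "(\<lambda>v. exp (- (real n * r v))) \<in> borel_measurable \<mu>" for n
      by (rule sphere_prob_measurable[OF \<mu>]) (intro continuous_intros r)
    show "AE v in \<mu>. (\<lambda>n. exp (- (real n * r v))) \<longlonglongrightarrow> indicat_real {w} v"
    proof (rule AE_I2)
      fix v assume "v \<in> space \<mu>"
      then have v: "v \<in> unit_sphere" using space_sphere_prob[OF \<mu>] by simp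
      show "(\<lambda>n. exp (- (real n * r v))) \<longlonglongrightarrow> indicat_real {w} v"
      proof (cases "v = w")
        case True
        then show ?thesis using zero[OF v] by simp
      next
        case False
        then have "exp (- r v) < 1" using zero[OF v] r(2)[OF v] by simp
        then have "(\<lambda>n. exp (- r v) ^ n) \<longlonglongrightarrow> 0" by (intro LIMSEQ_realpow_zero) auto
        then show ?thesis using False by (simp add: exp_of_nat_mult[symmetric])
      qed
    qed
    show "AE v in \<mu>. norm (exp (- (real n * r v))) \<le> 1" for n
      by (rule AE_I2) (use r(2) in \<open>auto simp: space_sphere_prob[OF \<mu>]\<close>)
  qed simp
  then show ?thesis using ws by simp
qed

text \<open>The mixture is carried by the two points, on which every function agrees with a combination of
  indicators.\<close>
lemma integral_mixture_dirac:
  fixes a b :: "real ^ 'n" and \<phi> :: "real ^ 'n \<Rightarrow> real"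
  assumes a: "a \<in> unit_sphere" and b: "b \<in> unit_sphere" and "a \<noteq> b"
    and m: "0 \<le> m" "m \<le> 1" and \<phi>: "continuous_on unit_sphere \<phi>"
  shows "(LINT v|mixture m (dirac a) (dirac b). \<phi> v) = (1 - m) * \<phi> a + m * \<phi> b"
proof -
  let ?M = "mixture m (dirac a) (dirac b)"
  have sets: "sets ?M = sets sphere_borel" by (simp add: dirac_def)
  have sp: "space ?M = unit_sphere"
    using sets_eq_imp_space_eq[OF sets] by (simp add: space_restrict_space)
  have em: "emeasure ?M A = ennreal (1 - m) * indicator A a + ennreal m * indicator A b"
    if "A \<in> sets sphere_borel" for A
    using that by (subst emeasure_mixture) (auto simp: dirac_def)
  have ms: "A \<in> sets sphere_borel" if "A \<subseteq> unit_sphere" "finite A" for A :: "(real ^ 'n) set"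
    using that finite_imp_closed[OF that(2)] by (auto simp: sets_restrict_space intro!: image_eqI[of _ _ A])
  have meas: "borel_measurable ?M = (borel_measurable sphere_borel :: (real ^ 'n \<Rightarrow> real) set)"
    by (rule measurable_cong_sets[OF sets refl])
  have ab: "{a} \<in> sets sphere_borel" "{b} \<in> sets sphere_borel" "{a, b} \<in> sets sphere_borel"
    using a b by (auto intro: ms)
  have comp: "unit_sphere - {a, b} \<in> sets sphere_borel"
    using sets.compl_sets[OF ab(3)] by (simp add: space_restrict_space)
  have "emeasure ?M (unit_sphere - {a, b}) = 0" using em[OF comp] by simp
  then have "unit_sphere - {a, b} \<in> null_sets ?M" using comp sets by (simp add: null_sets_def)
  then have AE: "AE v in ?M. v = a \<or> v = b"
    by (rule AE_I') (auto simp: sp)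
  have ea: "emeasure ?M {a} = ennreal (1 - m)" "emeasure ?M {b} = ennreal m"
    using em[OF ab(1)] em[OF ab(2)] \<open>a \<noteq> b\<close> by auto
  then have mm: "measure ?M {a} = 1 - m" "measure ?M {b} = m" using m by (auto simp: measure_def)
  have "(LINT v|?M. \<phi> v) = (LINT v|?M. \<phi> a * indicat_real {a} v + \<phi> b * indicat_real {b} v)"
  proof (rule integral_cong_AE)
    show "\<phi> \<in> borel_measurable ?M" unfolding meas by (rule borel_measurable_continuous_on_restrict[OF \<phi>])
    show "(\<lambda>v. \<phi> a * indicat_real {a} v + \<phi> b * indicat_real {b} v) \<in> borel_measurable ?M"
      unfolding meas using ab by (intro borel_measurable_add borel_measurable_times borel_measurable_const borel_measurable_indicator)
    show "AE v in ?M. \<phi> v = \<phi> a * indicat_real {a} v + \<phi> b * indicat_real {b} v"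
      using AE by eventually_elim (use \<open>a \<noteq> b\<close> in auto)
  qed
  also have "\<dots> = \<phi> a * measure ?M {a} + \<phi> b * measure ?M {b}"
    using ab ea sets by (subst Bochner_Integration.integral_add) (auto simp: integrable_real_indicator)
  finally show ?thesis by (simp add: mm)
qed

section \<open>The limit of the measures\<close>

context aggregation
begin

text \<open>Any function of a quantity that is constant along flow lines has a constant integral. The
  exponential is used because its integrals for large \<open>k\<close> detect the set where the cross-ratio vanishes.\<close>
lemma cross_ratio_conserved:
  assumes y: "flow_line_on {0..} J y" and w: "flow_line_on {0..} J w" and y1: "\<And>t. t \<ge> 0 \<Longrightarrow> norm (y t) < 1"
    and t: "t \<ge> 0"
  shows "(LINT v|f t. exp (- (k * cross_ratio (y t) (w t) v))) = (LINT v|f 0. exp (- (k * cross_ratio (y 0) (w 0) v)))"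
proof -
  define \<Phi> where "\<Phi> s v = exp (- (k * cross_ratio (y s) (w s) v))" for s v
  define R where "R s v = (1 - y s \<bullet> y s) / (1 - y s \<bullet> w s) * ((J s \<bullet> (w s - y s)) * ((1 - v \<bullet> w s) / (1 - v \<bullet> y s))
      - (v \<bullet> proj_perp (w s) (J s)) / (1 - v \<bullet> y s)
      + (1 - v \<bullet> w s) * (v \<bullet> proj_perp (y s) (J s)) / (1 - v \<bullet> y s)\<^sup>2)" for s v
  define g where "g s v = ((1 - y s \<bullet> y s) / (1 - y s \<bullet> w s)) *\<^sub>R
      (((1 - v \<bullet> w s) / (1 - v \<bullet> y s)\<^sup>2) *\<^sub>R y s - (1 / (1 - v \<bullet> y s)) *\<^sub>R w s)" for s v
  have w1: "norm (w s) \<le> 1" if "s \<ge> 0" for s using flow_line_onD(1)[OF w] that by simp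
  have nz: "1 - y s \<bullet> w s \<noteq> 0" "v \<in> unit_sphere \<Longrightarrow> 1 - v \<bullet> y s \<noteq> 0" if "s \<ge> 0" for s v
    using inner_less_one[of "w s" "y s"] inner_less_one[of v "y s"] y1[OF that] w1[OF that] by (auto simp: inner_commute)
  have ycont: "continuous_on {0..} y" and wcont: "continuous_on {0..} w"
    using y w unfolding flow_line_on_def by (auto intro: continuous_on_vector_derivative)
  have cr_cont: "continuous_on ({0..} \<times> unit_sphere) (\<lambda>(s, v). cross_ratio (y s) (w s) v)"
    unfolding case_prod_unfold cross_ratio_def
    by (intro continuous_intros continuous_on_compose2[OF ycont] continuous_on_compose2[OF wcont]) (use nz in auto)
  have R_cont: "continuous_on ({0..} \<times> unit_sphere) (\<lambda>(s, v). R s v)"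
    unfolding case_prod_unfold R_def proj_perp_def
    by (intro continuous_intros continuous_on_compose2[OF ycont] continuous_on_compose2[OF wcont]
        continuous_on_compose2[OF J_cont]) (use nz in auto)
  have g_cont: "continuous_on unit_sphere (g s)" if "s \<ge> 0" for s
    unfolding g_def[abs_def] by (intro continuous_intros) (use nz[OF that] in auto)
  have "\<exists>c. \<forall>s\<in>{0..}. (LINT v|f s. \<Phi> s v) = c"
  proof (rule has_field_derivative_zero_constant)
    fix s :: real assume "s \<in> {0..}"
    then have s: "s \<ge> 0" by simp
    have "((\<lambda>s. LINT v|f s. \<Phi> s v) has_real_derivative
      (LINT v|f s. (\<Phi> s v * (- (k * R s v))) + proj_perp v (J s) \<bullet> ((- \<Phi> s v * k) *\<^sub>R g s v))) (at s within {0..})"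
    proof (rule transport_derivative[OF solution _ _ _ _ s])
      fix s v assume s: "s \<ge> (0::real)" and v: "v \<in> (unit_sphere :: (real ^ 'n) set)"
      have "((\<lambda>s. cross_ratio (y s) (w s) v) has_real_derivative R s v) (at s within {0..})"
        unfolding R_def by (rule cross_ratio_time_derivative[OF y w]) (use s v y1 in auto)
      then show "((\<lambda>s. \<Phi> s v) has_real_derivative \<Phi> s v * (- (k * R s v))) (at s within {0..})"
        unfolding \<Phi>_def by (auto intro!: derivative_eq_intros)
      have "(cross_ratio (y s) (w s) has_derivative (\<lambda>h. g s v \<bullet> h)) (at v)"
        unfolding g_def by (rule cross_ratio_space_derivative) (use nz[OF s] v in auto)
      then show "(\<Phi> s has_derivative (\<lambda>h. ((- \<Phi> s v * k) *\<^sub>R g s v) \<bullet> h)) (at v)"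
        unfolding \<Phi>_def[abs_def] by (auto intro!: derivative_eq_intros)
    next
      show "continuous_on ({0..} \<times> unit_sphere) (\<lambda>(s, v). \<Phi> s v * (- (k * R s v)))"
        using cr_cont R_cont unfolding case_prod_unfold \<Phi>_def by (intro continuous_intros)
      fix s :: real assume s: "s \<ge> 0"
      show "continuous_on unit_sphere (\<lambda>v. (- \<Phi> s v * k) *\<^sub>R g s v)"
        unfolding \<Phi>_def by (intro continuous_intros g_cont s cross_ratio_cont y1)
    qed
    also have "(LINT v|f s. (\<Phi> s v * (- (k * R s v))) + proj_perp v (J s) \<bullet> ((- \<Phi> s v * k) *\<^sub>R g s v)) = (LINT v|f s. 0)"
    proof (rule Bochner_Integration.integral_cong)
      fix v assume "v \<in> space (f s)"
      then have v: "v \<in> unit_sphere" using space_sphere_prob[OF sphere_prob[OF s]] by simp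
      have "R s v + proj_perp v (J s) \<bullet> g s v = (1 - y s \<bullet> y s) / (1 - y s \<bullet> w s) * 0"
        unfolding cross_ratio_transport[OF nz(2)[OF s v], of "J s" "w s", symmetric] R_def g_def inner_scaleR_right distrib_left
        by simp
      then show "(\<Phi> s v * (- (k * R s v))) + proj_perp v (J s) \<bullet> ((- \<Phi> s v * k) *\<^sub>R g s v) = 0"
        by (simp add: inner_scaleR_right distrib_left[symmetric] add_eq_0_iff2)
    qed simp
    finally show "((\<lambda>s. LINT v|f s. \<Phi> s v) has_real_derivative 0) (at s within {0..})" by simp
  qed simp
  then show ?thesis using t unfolding \<Phi>_def by (metis atLeast_iff order_refl)
qed

end

text \<open>The situation once \<open>J\<close> is known to converge: \<open>w\<close> is the flow line that tends to \<open>- \<Omega>\<close>, and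
  \<open>y\<close> the one that starts at the centre of the ball.\<close>
locale aggregation_limit = aggregation f0 f
  for f0 :: "(real ^ 'n) measure" and f :: "real \<Rightarrow> (real ^ 'n) measure" +
  fixes j :: real and \<Omega> :: "real ^ 'n" and w y :: "real \<Rightarrow> real ^ 'n"
  assumes J_lim: "(J \<longlongrightarrow> j *\<^sub>R \<Omega>) at_top" and j_pos: "j > 0" and norm_\<Omega>: "norm \<Omega> = 1"
    and w_flow: "flow_line_on {0..} J w" and w_start: "norm (w 0) = 1" and w_lim: "(w \<longlongrightarrow> - \<Omega>) at_top"
    and y_flow: "flow_line_on {0..} J y" and y_start: "y 0 = 0" and y_lim: "(y \<longlongrightarrow> \<Omega>) at_top"
begin

lemma norm_w: "t \<ge> 0 \<Longrightarrow> norm (w t) = 1"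
  by (rule flow_line_norm_eq_1[of 0 t J]) (auto intro: flow_line_on_subset[OF w_flow] J_norm_le w_start)

lemma norm_y: "t \<ge> 0 \<Longrightarrow> norm (y t) < 1"
  by (rule flow_line_norm_less_1[of 0 t J]) (auto intro: flow_line_on_subset[OF y_flow] J_norm_le simp: y_start)

lemma inner_\<Omega>: "\<Omega> \<bullet> \<Omega> = 1"
  using norm_\<Omega> by (simp add: power2_norm_eq_inner[symmetric])

definition back_mass :: real where "back_mass = measure (f 0) {w 0}"

lemma laplace_start:
  assumes "t \<ge> 0"
  shows "(LINT v|f t. exp (- (k * cross_ratio (y t) (w t) v))) = (LINT v|f 0. exp (- (k * (1 - v \<bullet> w 0))))"
  using cross_ratio_conserved[OF y_flow w_flow norm_y assms, of k] by (simp add: y_start cross_ratio_def)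

lemma laplace_limit_start: "(\<lambda>n. LINT v|f 0. exp (- (real n * (1 - v \<bullet> w 0)))) \<longlonglongrightarrow> back_mass"
  unfolding back_mass_def
proof (rule laplace_tendsto_atom)
  fix v :: "real ^ 'n" assume v: "v \<in> unit_sphere"
  show "1 - v \<bullet> w 0 \<ge> 0" using inner_le_one[of v "w 0"] v w_start by simp
  show "1 - v \<bullet> w 0 = 0 \<longleftrightarrow> v = w 0"
    using norm_diff_le_gap[of v "w 0"] v w_start by (auto simp: power2_norm_eq_inner[symmetric])
qed (auto intro!: continuous_intros sphere_prob simp: w_start)

text \<open>The cross-ratio vanishes at time \<open>t\<close> only at \<open>w t\<close>, so both sides are limits of the same conserved
  integrals.\<close>
lemma atom_conserved:
  assumes t: "t \<ge> 0"
  shows "measure (f t) {w t} = back_mass"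
proof (rule LIMSEQ_unique)
  show "(\<lambda>n. LINT v|f t. exp (- (real n * cross_ratio (y t) (w t) v))) \<longlonglongrightarrow> measure (f t) {w t}"
    by (rule laplace_tendsto_atom[OF sphere_prob[OF t]])
      (use norm_y[OF t] norm_w[OF t] in \<open>auto intro: cross_ratio_cont cross_ratio_nonneg simp: cross_ratio_eq_0_iff\<close>)
  show "(\<lambda>n. LINT v|f t. exp (- (real n * cross_ratio (y t) (w t) v))) \<longlonglongrightarrow> back_mass"
    using laplace_limit_start by (simp add: laplace_start[OF t])
qed

lemma cap_sets:
  assumes "t \<ge> 0"
  shows "{v \<in> unit_sphere. v \<bullet> \<Omega> \<le> c} \<in> sets (f t)"
proof -
  have "{v \<in> unit_sphere. v \<bullet> \<Omega> \<le> c} = {v. v \<bullet> \<Omega> \<le> c} \<inter> unit_sphere" by auto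
  then show ?thesis
    using sphere_prob_sets[OF sphere_prob[OF assms], of "{v. v \<bullet> \<Omega> \<le> c}"]
    by (simp add: closed_halfspace_component_le closed_Collect_le continuous_intros)
qed

text \<open>Away from \<open>\<Omega>\<close> the cross-ratio is eventually as small as desired, so there \<open>exp (- n \<rho>)\<close> is
  close to \<open>1\<close> and its conserved integral bounds the mass from above; for large \<open>n\<close> this integral is close
  to the mass of the atom.\<close>
lemma back_cap_mass_le:
  assumes "c < 1" "\<eta> > 0"
  shows "\<forall>\<^sub>F t in at_top. measure (f t) {v \<in> unit_sphere. v \<bullet> \<Omega> \<le> c} \<le> back_mass + \<eta>"
proof -
  have "\<forall>\<^sub>F n in sequentially. (LINT v|f 0. exp (- (real n * (1 - v \<bullet> w 0)))) < back_mass + \<eta> / 2"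
    using laplace_limit_start by (rule order_tendstoD) (use assms in simp)
  then obtain n where n: "(LINT v|f 0. exp (- (real n * (1 - v \<bullet> w 0)))) < back_mass + \<eta> / 2"
    using eventually_happens'[OF sequentially_bot] by blast
  (* s bounds the cross-ratio on the cap: the numerator of the last quotient is at most 2, and its
     denominator is at least (1 - c) / 2 once y is close to \<Omega>. *)
  define s where "s t = (1 - y t \<bullet> y t) / (1 - y t \<bullet> w t) * (4 / (1 - c))" for t
  have "((\<lambda>t. n * s t) \<longlongrightarrow> real n * ((1 - \<Omega> \<bullet> \<Omega>) / (1 - \<Omega> \<bullet> (- \<Omega>)) * (4 / (1 - c)))) at_top"
    unfolding s_def by (intro tendsto_intros y_lim w_lim) (use assms inner_\<Omega> in auto)
  then have "((\<lambda>t. n * s t) \<longlongrightarrow> 0) at_top" by (simp add: inner_\<Omega>)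
  then have small: "\<forall>\<^sub>F t in at_top. n * s t < \<eta> / 2" by (rule order_tendstoD) (use assms in simp)
  have close: "\<forall>\<^sub>F t in at_top. dist (y t) \<Omega> < (1 - c) / 2"
    using y_lim by (rule tendstoD) (use assms in simp)
  show ?thesis
    using small close eventually_ge_at_top[of 0]
  proof eventually_elim
    case (elim t)
    then have t: "t \<ge> 0" by simp
    interpret prob_space "f t" by (rule prob_space_sphere_prob[OF sphere_prob[OF t]])
    let ?A = "{v \<in> unit_sphere. v \<bullet> \<Omega> \<le> c}"
    let ?\<rho> = "cross_ratio (y t) (w t)"
    have cont: "continuous_on unit_sphere (\<lambda>v. exp (- (real n * ?\<rho> v)) + n * s t)"
      by (intro continuous_intros cross_ratio_cont norm_y t)
    have yy: "y t \<bullet> y t < 1" "y t \<bullet> w t < 1"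
      using inner_less_one[of "y t" "y t"] inner_less_one[of "w t" "y t"] norm_y[OF t] norm_w[OF t]
      by (auto simp: inner_commute)
    have s0: "s t \<ge> 0" using yy assms by (simp add: s_def)
    have bound: "?\<rho> v \<le> s t" if v: "v \<in> ?A" for v
    proof -
      have nv: "norm v = 1" using v by simp
      have "v \<bullet> (y t - \<Omega>) \<le> norm v * norm (y t - \<Omega>)" by (rule norm_cauchy_schwarz)
      also have "\<dots> < (1 - c) / 2" using elim nv by (simp add: dist_norm)
      finally have q: "(1 - c) / 2 \<le> 1 - v \<bullet> y t" using v by (simp add: inner_diff_right field_simps)
      have "(1 - v \<bullet> w t) / (1 - v \<bullet> y t) \<le> 2 / ((1 - c) / 2)"
        using q assms inner_le_one[of v "w t"] nv norm_w[OF t] by (intro frac_le) auto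
      also have "\<dots> = 4 / (1 - c)" by simp
      finally show ?thesis
        unfolding s_def cross_ratio_def using yy by (intro mult_left_mono) auto
    qed
    have "measure (f t) ?A = (LINT v|f t. indicat_real ?A v)" using cap_sets[OF t] by simp
    also have "\<dots> \<le> (LINT v|f t. exp (- (real n * ?\<rho> v)) + n * s t)"
    proof (rule integral_mono)
      show "integrable (f t) (indicat_real ?A)" using cap_sets[OF t] by (simp add: integrable_real_indicator less_top[symmetric])
      show "integrable (f t) (\<lambda>v. exp (- (real n * ?\<rho> v)) + n * s t)"
        by (rule sphere_prob_integrable[OF sphere_prob[OF t] cont])
      fix v assume "v \<in> space (f t)"
      show "indicat_real ?A v \<le> exp (- (real n * ?\<rho> v)) + n * s t"
      proof (cases "v \<in> ?A")
        case True
        have "real n * ?\<rho> v \<le> n * s t" using bound[OF True] by (intro mult_left_mono) auto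
        then show ?thesis using exp_ge_add_one_self[of "- (real n * ?\<rho> v)"] True by (simp only: indicator_simps)
      next
        case False
        then show ?thesis using s0 by (simp add: add_nonneg_nonneg)
      qed
    qed
    also have "\<dots> = (LINT v|f t. exp (- (real n * ?\<rho> v))) + n * s t"
      by (subst Bochner_Integration.integral_add)
        (auto intro!: sphere_prob_integrable sphere_prob t continuous_intros cross_ratio_cont norm_y simp: prob_space)
    also have "\<dots> \<le> back_mass + \<eta>" using n elim by (simp add: laplace_start[OF t])
    finally show ?case .
  qed
qed

text \<open>The atom at \<open>w t\<close> is separated from the rest. Of the remaining mass \<open>1 - back_mass\<close>, a small part lies in
  the cap \<open>v \<bullet> \<Omega> \<le> c\<close>, because the atom already accounts for nearly all the mass of that cap; elsewhere
  \<open>\<phi>\<close> is close to \<open>\<phi> \<Omega>\<close>.\<close>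
lemma integral_tendsto:
  fixes \<phi> :: "real ^ 'n \<Rightarrow> real"
  assumes \<phi>: "continuous_on unit_sphere \<phi>"
  shows "((\<lambda>t. LINT v|f t. \<phi> v) \<longlongrightarrow> (1 - back_mass) * \<phi> \<Omega> + back_mass * \<phi> (- \<Omega>)) at_top"
proof -
  have ev0: "\<forall>\<^sub>F t in at_top. t \<ge> (0::real)" by (rule eventually_ge_at_top)
  have "\<forall>\<^sub>F t in at_top. w t \<in> unit_sphere" using ev0 by eventually_elim (simp add: norm_w)
  then have \<phi>w: "((\<lambda>t. \<phi> (w t)) \<longlongrightarrow> \<phi> (- \<Omega>)) at_top"
    by (intro continuous_on_tendsto_compose[OF \<phi> w_lim]) (use norm_\<Omega> in auto)
  have "((\<lambda>t. (LINT v|f t. \<phi> v) - (\<phi> \<Omega> + back_mass * (\<phi> (w t) - \<phi> \<Omega>))) \<longlongrightarrow> 0) at_top"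
  proof (rule tendstoI)
    fix e :: real assume "e > 0"
    have "compact (\<phi> ` unit_sphere)" by (rule compact_continuous_image[OF \<phi>]) simp
    then obtain B where "B > 0" and B: "\<forall>x\<in>\<phi> ` unit_sphere. norm x \<le> B" using bounded_pos compact_imp_bounded by blast
    obtain d where d: "d > 0" "\<And>v. v \<in> unit_sphere \<Longrightarrow> dist v \<Omega> < d \<Longrightarrow> dist (\<phi> v) (\<phi> \<Omega>) < e / 3"
      using \<phi> norm_\<Omega> \<open>e > 0\<close> unfolding continuous_on_iff
      by (metis divide_pos_pos mem_sphere_0 zero_less_numeral)
    define c where "c = max (1 - d\<^sup>2 / 4) 0"
    have c: "c < 1" using d(1) by (simp add: c_def)
    have near: "\<bar>\<phi> v - \<phi> \<Omega>\<bar> \<le> e / 3" if v: "v \<in> unit_sphere" "v \<bullet> \<Omega> > c" for v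
    proof -
      have "(norm (v - \<Omega>))\<^sup>2 \<le> 2 * (1 - v \<bullet> \<Omega>)" by (rule norm_diff_le_gap) (use v norm_\<Omega> in auto)
      also have "\<dots> < d\<^sup>2"
      proof -
        have "v \<bullet> \<Omega> > 1 - d\<^sup>2 / 4" using v(2) by (simp add: c_def)
        moreover have "d\<^sup>2 > 0" using d(1) by simp
        moreover have "2 * (1 - v \<bullet> \<Omega>) = 2 - 2 * (v \<bullet> \<Omega>)" by simp
        ultimately show ?thesis by linarith
      qed
      finally have "norm (v - \<Omega>) < d" using d(1) by (simp add: power2_less_imp_less)
      then show ?thesis using d(2)[OF v(1)] by (simp add: dist_norm dist_real_def)
    qed
    have wback: "\<forall>\<^sub>F t in at_top. w t \<bullet> \<Omega> < c"
    proof (rule order_tendstoD)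
      show "((\<lambda>t. w t \<bullet> \<Omega>) \<longlongrightarrow> (- \<Omega>) \<bullet> \<Omega>) at_top" by (intro tendsto_intros w_lim)
      show "(- \<Omega>) \<bullet> \<Omega> < c" by (simp add: inner_\<Omega> c_def)
    qed
    have mass: "\<forall>\<^sub>F t in at_top. measure (f t) {v \<in> unit_sphere. v \<bullet> \<Omega> \<le> c} \<le> back_mass + e / (6 * B)"
      by (rule back_cap_mass_le[OF c]) (use \<open>e > 0\<close> \<open>B > 0\<close> in simp)
    show "\<forall>\<^sub>F t in at_top. dist ((LINT v|f t. \<phi> v) - (\<phi> \<Omega> + back_mass * (\<phi> (w t) - \<phi> \<Omega>))) 0 < e"
      using wback mass ev0
    proof eventually_elim
      case (elim t)
      then have t: "t \<ge> 0" by simp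
      interpret prob_space "f t" by (rule prob_space_sphere_prob[OF sphere_prob[OF t]])
      let ?A = "{v \<in> unit_sphere. v \<bullet> \<Omega> \<le> c}"
      have ws: "{w t} \<in> sets (f t)"
        using sphere_prob_sets[OF sphere_prob[OF t], of "{w t}"] norm_w[OF t] by simp
      have int: "integrable (f t) \<phi>" "integrable (f t) (indicat_real {w t})" "integrable (f t) (indicat_real ?A)"
        using sphere_prob_integrable[OF sphere_prob[OF t] \<phi>] ws cap_sets[OF t]
        by (auto simp: integrable_real_indicator less_top[symmetric])
      let ?h = "\<lambda>v. \<phi> v - (\<phi> \<Omega> + (\<phi> (w t) - \<phi> \<Omega>) * indicat_real {w t} v)"
      have "(LINT v|f t. ?h v) = (LINT v|f t. \<phi> v) - (\<phi> \<Omega> + back_mass * (\<phi> (w t) - \<phi> \<Omega>))"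
        using int ws by (simp add: atom_conserved[OF t] prob_space mult.commute)
      moreover have "\<bar>LINT v|f t. ?h v\<bar> \<le> (LINT v|f t. e / 3 + 2 * B * (indicat_real ?A v - indicat_real {w t} v))"
      proof (rule order_trans[OF integral_abs_bound], rule integral_mono)
        show "integrable (f t) (\<lambda>v. \<bar>?h v\<bar>)" using int by simp
        show "integrable (f t) (\<lambda>v. e / 3 + 2 * B * (indicat_real ?A v - indicat_real {w t} v))" using int by simp
        fix v assume "v \<in> space (f t)"
        then have v: "v \<in> unit_sphere" using space_sphere_prob[OF sphere_prob[OF t]] by simp
        show "\<bar>?h v\<bar> \<le> e / 3 + 2 * B * (indicat_real ?A v - indicat_real {w t} v)"
        proof (cases "v = w t")
          case True
          then show ?thesis using elim v \<open>e > 0\<close> by simp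
        next
          case neq: False
          show ?thesis
          proof (cases "v \<in> ?A")
            case True
            have "\<bar>\<phi> v\<bar> \<le> B" "\<bar>\<phi> \<Omega>\<bar> \<le> B" using B v norm_\<Omega> by auto
            then have "\<bar>\<phi> v - \<phi> \<Omega>\<bar> \<le> 2 * B" by linarith
            then show ?thesis using True neq \<open>e > 0\<close> by simp
          next
            case False
            then show ?thesis using near[OF v] v neq by simp
          qed
        qed
      qed
      moreover have "(LINT v|f t. e / 3 + 2 * B * (indicat_real ?A v - indicat_real {w t} v)) = e / 3 + 2 * B * (measure (f t) ?A - back_mass)"
        using int ws cap_sets[OF t] by (simp add: atom_conserved[OF t] prob_space)
      moreover have "2 * B * (measure (f t) ?A - back_mass) \<le> 2 * B * (e / (6 * B))"
        using elim \<open>B > 0\<close> by (intro mult_left_mono) auto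
      moreover have "2 * B * (e / (6 * B)) = e / 3" using \<open>B > 0\<close> by simp
      ultimately show ?case using \<open>e > 0\<close> by simp
    qed
  qed
  from tendsto_add[OF this tendsto_add[OF tendsto_const tendsto_mult[OF tendsto_const tendsto_diff[OF \<phi>w tendsto_const]]], of "\<phi> \<Omega>" back_mass "\<phi> \<Omega>"]
  show ?thesis by (simp add: algebra_simps)
qed

text \<open>The limit measure has first moment \<open>(1 - 2 back_mass) \<Omega>\<close>, which must be the limit \<open>j \<Omega>\<close> of \<open>J\<close>.\<close>
lemma atom_less_half: "back_mass < 1 / 2"
proof -
  have 1: "((\<lambda>t. LINT v|f t. v \<bullet> \<Omega>) \<longlongrightarrow> (1 - back_mass) * (\<Omega> \<bullet> \<Omega>) + back_mass * ((- \<Omega>) \<bullet> \<Omega>)) at_top"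
    by (rule integral_tendsto) (intro continuous_intros)
  have 2: "((\<lambda>t. J t \<bullet> \<Omega>) \<longlongrightarrow> (j *\<^sub>R \<Omega>) \<bullet> \<Omega>) at_top" by (intro tendsto_intros J_lim)
  have 3: "\<forall>\<^sub>F t in at_top. (LINT v|f t. v \<bullet> \<Omega>) = J t \<bullet> \<Omega>"
    using eventually_ge_at_top[of 0] by eventually_elim (simp add: first_moment_inner sphere_prob)
  have "(1 - back_mass) * (\<Omega> \<bullet> \<Omega>) + back_mass * ((- \<Omega>) \<bullet> \<Omega>) = (j *\<^sub>R \<Omega>) \<bullet> \<Omega>"
    by (rule tendsto_unique[OF trivial_limit_at_top_linorder Lim_transform_eventually[OF 1 3] 2])
  then show ?thesis using j_pos by (simp add: inner_\<Omega>)
qed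

end

theorem theorem1:
  fixes f0 :: "(real ^ 'n) measure" and f :: "real \<Rightarrow> (real ^ 'n) measure"
  assumes "sphere_prob f0"
    and "aggregation_solution f0 f"
    and "first_moment (f 0) \<noteq> 0"
  shows "mono_on {0..} (\<lambda>t. norm (first_moment (f t)))
    \<and> (\<forall>t\<ge>0. first_moment (f t) \<noteq> 0 \<and> direction f t \<in> unit_sphere)
    \<and> (\<exists>\<Omega>\<in>unit_sphere.
        (direction f \<longlongrightarrow> \<Omega>) at_top
        \<and> (\<exists>!vb. vb \<in> unit_sphere \<and> the_char_solution_tends_to f vb (- \<Omega>))
        \<and> (\<forall>vb. vb \<in> unit_sphere \<and> the_char_solution_tends_to f vb (- \<Omega>) \<longrightarrow>
            measure f0 {vb} < 1 / 2
            \<and> weakly_converges f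
                (mixture (measure f0 {vb}) (dirac \<Omega>) (dirac (- \<Omega>))) at_top))"
proof -
  interpret aggregation f0 f by unfold_locales (rule assms)+
  have f0: "f 0 = f0" using assms(2) by (simp add: aggregation_solution_def)
  obtain L where L: "(J \<longlongrightarrow> L) at_top" "L \<noteq> 0" by (rule J_convergent)
  define j where "j = norm L"
  define \<Omega> where "\<Omega> = L /\<^sub>R norm L"
  have j\<Omega>: "j > 0" "norm \<Omega> = 1" "j *\<^sub>R \<Omega> = L" using L(2) by (auto simp: j_def \<Omega>_def)
  interpret convergent_field J j \<Omega>
    by unfold_locales (use J_cont J_norm_le L j\<Omega> in auto)
  obtain w where w: "flow_line_on {0..} J w" "norm (w 0) = 1" "(w \<longlongrightarrow> - \<Omega>) at_top" by (rule back_line_exists)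
  obtain y where y: "y 0 = 0" "flow_line_on {0..} J y" using flow_line_from[of 0] by auto
  have "(y \<longlongrightarrow> \<Omega>) at_top" by (rule front_line_tendsto[OF w(1,3) y(2)]) (simp add: y(1))
  then interpret aggregation_limit f0 f j \<Omega> w y
    by unfold_locales (use L j\<Omega> w y in auto)
  have char_flow: "flow_line_on {0..} J v" if "char_solution f v0 v" for v0 v
    using that by (auto simp: char_solution_def flow_line_on_def)
  have w_char: "char_solution f (w 0) w"
    using w(1) norm_w by (auto simp: char_solution_def flow_line_on_def)
  have w_tends: "the_char_solution_tends_to f (w 0) (- \<Omega>)"
    unfolding the_char_solution_tends_to_def
  proof (intro exI[of _ w] conjI allI impI)
    fix u t assume u: "char_solution f (w 0) u" and t: "(0::real) \<le> t"
    show "u t = w t"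
      by (rule flow_line_unique[OF char_flow[OF u] w(1) J_norm_le _ _ t])
        (use u w(2) in \<open>auto simp: char_solution_def\<close>)
  qed (use w_char w in auto)
  have vb_eq: "vb = w 0" if vb: "vb \<in> unit_sphere" "the_char_solution_tends_to f vb (- \<Omega>)" for vb
  proof -
    obtain u where u: "char_solution f vb u" "(u \<longlongrightarrow> - \<Omega>) at_top"
      using vb(2) by (auto simp: the_char_solution_tends_to_def)
    have "u 0 = vb" using u(1) by (simp add: char_solution_def)
    then show ?thesis
      using back_line_unique[OF char_flow[OF u(1)] _ u(2) w] vb(1) by simp
  qed
  have mass: "back_mass = measure f0 {w 0}" by (simp add: back_mass_def f0)
  have weak: "weakly_converges f (mixture back_mass (dirac \<Omega>) (dirac (- \<Omega>))) at_top"
    unfolding weakly_converges_def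
  proof (intro allI impI)
    fix \<phi> :: "real ^ 'n \<Rightarrow> real" assume \<phi>: "continuous_on unit_sphere \<phi>"
    have "\<Omega> \<noteq> - \<Omega>"
    proof
      assume "\<Omega> = - \<Omega>"
      then have "\<Omega> \<bullet> \<Omega> = (- \<Omega>) \<bullet> \<Omega>" by (rule arg_cong)
      then show False by (simp add: inner_\<Omega>)
    qed
    then have "(LINT v|mixture back_mass (dirac \<Omega>) (dirac (- \<Omega>)). \<phi> v) = (1 - back_mass) * \<phi> \<Omega> + back_mass * \<phi> (- \<Omega>)"
      by (intro integral_mixture_dirac) (use j\<Omega>(2) atom_less_half \<phi> in \<open>auto simp: back_mass_def\<close>)
    then show "((\<lambda>t. LINT v|f t. \<phi> v) \<longlongrightarrow> (LINT v|mixture back_mass (dirac \<Omega>) (dirac (- \<Omega>)). \<phi> v)) at_top"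
      using integral_tendsto[OF \<phi>] by simp
  qed
  have "(direction f \<longlongrightarrow> L /\<^sub>R norm L) at_top"
    unfolding direction_def[abs_def] by (intro tendsto_intros L) (use L(2) in simp)
  then have dir: "(direction f \<longlongrightarrow> \<Omega>) at_top" by (simp add: \<Omega>_def)
  show ?thesis
  proof (intro conjI bexI[of _ \<Omega>])
    show "mono_on {0..} (\<lambda>t. norm (J t))" by (intro mono_onI norm_J_mono) auto
    show "\<forall>t\<ge>0. J t \<noteq> 0 \<and> direction f t \<in> unit_sphere"
      by (simp add: direction_def J_nonzero)
    show "(direction f \<longlongrightarrow> \<Omega>) at_top" by (rule dir)
    show "\<exists>!vb. vb \<in> unit_sphere \<and> the_char_solution_tends_to f vb (- \<Omega>)"
    proof (rule ex1I)
      show "w 0 \<in> unit_sphere \<and> the_char_solution_tends_to f (w 0) (- \<Omega>)" using w(2) w_tends by simp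
    qed (blast intro: vb_eq)
    show "\<forall>vb. vb \<in> unit_sphere \<and> the_char_solution_tends_to f vb (- \<Omega>) \<longrightarrow>
            measure f0 {vb} < 1 / 2
            \<and> weakly_converges f (mixture (measure f0 {vb}) (dirac \<Omega>) (dirac (- \<Omega>))) at_top"
    proof (intro allI impI)
      fix vb assume "vb \<in> unit_sphere \<and> the_char_solution_tends_to f vb (- \<Omega>)"
      then have "vb = w 0" by (blast intro: vb_eq)
      then show "measure f0 {vb} < 1 / 2
          \<and> weakly_converges f (mixture (measure f0 {vb}) (dirac \<Omega>) (dirac (- \<Omega>))) at_top"
        using atom_less_half weak mass by simp
    qed
  qed (use j\<Omega> in simp)
qed

end
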